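(* (Clausius-Clapeyron relation) The slope of the phase transition curve $\beta_{\rm cr}(\rho)$ is related to the ratio of the jump discontinuities of the first partial derivatives of $\lambda(\rho,\beta)$ across the curve by $$\frac{d\beta_{\rm cr}}{d\rho}=-\frac{\Delta\left(\frac{\partial\lambda(\rho,\beta)}{\partial\rho}\right)}{\Delta\left(\frac{\partial\lambda(\rho,\beta)}{\partial\beta}\right)}=-\frac{2}{\rho(d_1+d_2)},$$ where $d_1<d_2$ are the solutions of the variational problem for $\Lambda(d)$ at the point $(\rho,\beta_{\rm cr}(\rho))$ of the phase transition curve, and the jump discontinuities across the curve are $$\Delta\left(\frac{\partial\lambda}{\partial\rho}\right)=\left.\frac{\partial\lambda}{\partial\rho}\right|_{d_2}-\left.\frac{\partial\lambda}{\partial\rho}\right|_{d_1},\qquad \Delta\left(\frac{\partial\lambda}{\partial\beta}\right)=\left.\frac{\partial\lambda}{\partial\beta}\right|_{d_2}-\left.\frac{\partial\lambda}{\partial\beta}\right|_{d_1}.$$ The two solutions become equal at the critical point: $\lim_{\rho\to\rho_c}(d_2-d_1)=0$.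
   Context: For $\rho>0,\beta>0$ the Lyapunov exponent is $\lambda(\rho,\beta)=\lim_{n\to\infty}\frac1n\log\mathbb{E}[x_n]$, where $x_{i+1}=a_ix_i$, $x_0>0$ deterministic, $a_i=1+\rho e^{\sigma W(t_i)-\frac12\sigma^2t_i}$, $t_i=i\tau$, $W$ a standard Brownian motion, and the limit is taken with $\frac12\sigma^2\tau n^2=\beta$ fixed. It satisfies $\lambda(\rho,\beta)=\sup_{d\in(0,1)}\Lambda(d)$ with $$\Lambda(d)=\beta d^2+\log(1+\rho)-2\beta(1+\rho)d^3\int_0^1\frac{y^2\,dy}{1+\rho-e^{\beta d^2(y^2-1)}}.$$ Equivalently, $\lambda(\rho,\beta)$ is the supremum over $h(1)$ of $\log(1+e^{h(1)})-\frac1{\sqrt\beta}\int_{\log\rho}^{h(1)}\sqrt{\log\frac{1+e^{h(1)}}{1+e^x}}\,dx$, with the variables related by $d=\frac{1}{\sqrt\beta}\sqrt{\log\frac{1+e^{h(1)}}{1+\rho}}$. The solutions of the variational problem are the values of $d$ at which the supremum is attained. The phase transition curve is the set of $(\rho,\beta)$ at which the supremum of $\Lambda(d)$ is attained at two distinct points $d_1<d_2$. It is taken to be a curve $\beta=\beta_{\rm cr}(\rho)$, $0<\rho<\rho_c$, differentiable in $\rho$, ending at the critical point $(\rho_c,\beta_c)$. The critical point is defined as follows: with $F(a;\rho)=\int_{\log\rho}^{a}\big(\log\frac{1+e^a}{1+e^x}\big)^{-1/2}dx$ for $a>\log\rho$, $\rho_c=\sup\{\rho:\exists a,\ \partial_aF(a;\rho)<0\}$,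 $a_c$ satisfies $\partial_aF(a_c;\rho_c)=0$, and $2\sqrt{\beta_c}=F(a_c;\rho_c)$. Off the curve the maximizer $d$ is unique and $\lambda$ is differentiable. The notation $|_{d_j}$ denotes the limit of the partial derivative as the point of the curve is approached from the side (phase) on which the unique maximizer tends to $d_j$. *)

theory Defs
  imports "HOL-Probability.Probability"
begin

locale standard_brownian_motion = prob_space M for M :: "'a measure" +
  fixes W :: "real \<Rightarrow> 'a \<Rightarrow> real"
  assumes W_measurable: "\<And>t. 0 \<le> t \<Longrightarrow> W t \<in> borel_measurable M"
    and W_zero: "AE \<omega> in M. W 0 \<omega> = 0"
    and W_gaussian: "\<And>s t. 0 \<le> s \<Longrightarrow> s < t \<Longrightarrow>
          distributed M lborel (\<lambda>\<omega>. W t \<omega> - W s \<omega>) (normal_density 0 (sqrt (t - s)))"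
    and W_indep: "\<And>(t :: nat \<Rightarrow> real) n. 0 \<le> t 0 \<Longrightarrow> (\<And>i. i < n \<Longrightarrow> t i < t (Suc i)) \<Longrightarrow>
          indep_vars (\<lambda>_. borel) (\<lambda>i \<omega>. W (t (Suc i)) \<omega> - W (t i) \<omega>) {..<n}"
    and W_continuous: "AE \<omega> in M. continuous_on {0..} (\<lambda>t. W t \<omega>)"

primrec growth_process ::
  "(real \<Rightarrow> 'a \<Rightarrow> real) \<Rightarrow> real \<Rightarrow> real \<Rightarrow> real \<Rightarrow> real \<Rightarrow> nat \<Rightarrow> 'a \<Rightarrow> real" where
  "growth_process W x0 \<rho> \<sigma> \<tau> 0 \<omega> = x0"
| "growth_process W x0 \<rho> \<sigma> \<tau> (Suc i) \<omega> =
     (1 + \<rho> * exp (\<sigma> * W (real i * \<tau>) \<omega> - \<sigma>\<^sup>2 * (real i * \<tau>) / 2)) * growth_process W x0 \<rho> \<sigma> \<tau> i \<omega>"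

text \<open>The parameters \<open>\<sigma>\<close> and \<open>\<tau>\<close> may both vary with \<open>n\<close>; only the combination \<open>\<beta>\<close> is held fixed.\<close>

definition is_lyapunov_exponent ::
  "'a measure \<Rightarrow> (real \<Rightarrow> 'a \<Rightarrow> real) \<Rightarrow> real \<Rightarrow> real \<Rightarrow> real \<Rightarrow> real \<Rightarrow> bool" where
  "is_lyapunov_exponent M W x0 \<rho> \<beta> L \<longleftrightarrow>
     (\<forall>\<sigma> \<tau> :: nat \<Rightarrow> real.
        (\<forall>n>0. \<sigma> n > 0 \<and> \<tau> n > 0 \<and> (\<sigma> n)\<^sup>2 * \<tau> n * (real n)\<^sup>2 / 2 = \<beta>) \<longrightarrow>
        (\<lambda>n. ln (\<integral>\<omega>. growth_process W x0 \<rho> (\<sigma> n) (\<tau> n) n \<omega> \<partial>M) / real n) \<longlonglongrightarrow> L)"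

definition Lambda :: "real \<Rightarrow> real \<Rightarrow> real \<Rightarrow> real" where
  "Lambda \<rho> \<beta> d = \<beta> * d\<^sup>2 + ln (1 + \<rho>)
     - 2 * \<beta> * (1 + \<rho>) * d ^ 3 *
       integral {0..1} (\<lambda>y. y\<^sup>2 / (1 + \<rho> - exp (\<beta> * d\<^sup>2 * (y\<^sup>2 - 1))))"

definition variational_solutions :: "real \<Rightarrow> real \<Rightarrow> real set" where
  "variational_solutions \<rho> \<beta> =
     {d \<in> {0<..<1}. \<forall>e \<in> {0<..<1}. Lambda \<rho> \<beta> e \<le> Lambda \<rho> \<beta> d}"

definition optimal_d :: "real \<Rightarrow> real \<Rightarrow> real" where
  "optimal_d \<rho> \<beta> = (THE d. d \<in> variational_solutions \<rho> \<beta>)"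

definition phase_transition_curve :: "(real \<times> real) set" where
  "phase_transition_curve = {(\<rho>, \<beta>). 0 < \<rho> \<and> 0 < \<beta> \<and>
     (\<exists>d1 d2. d1 < d2 \<and> d1 \<in> variational_solutions \<rho> \<beta> \<and> d2 \<in> variational_solutions \<rho> \<beta>)}"

text \<open>The integrand is singular at the endpoint \<open>x = a\<close>, where \<open>powr\<close> takes the value \<open>0\<close>;
  the integral converges for \<open>a > ln \<rho>\<close>.\<close>

definition crit_integral :: "real \<Rightarrow> real \<Rightarrow> real" where
  "crit_integral a \<rho> = integral {ln \<rho>..a} (\<lambda>x. ln ((1 + exp a) / (1 + exp x)) powr (- 1 / 2))"

definition is_critical_point :: "real \<Rightarrow> real \<Rightarrow> bool" where
  "is_critical_point \<rho>\<^sub>c \<beta>\<^sub>c \<longleftrightarrow> 0 < \<rho>\<^sub>c \<and> 0 < \<beta>\<^sub>c \<and>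
     \<rho>\<^sub>c = Sup {\<rho>. 0 < \<rho> \<and> (\<exists>a > ln \<rho>. deriv (\<lambda>a. crit_integral a \<rho>) a < 0)} \<and>
     (\<exists>a\<^sub>c > ln \<rho>\<^sub>c. deriv (\<lambda>a. crit_integral a \<rho>\<^sub>c) a\<^sub>c = 0 \<and> 2 * sqrt \<beta>\<^sub>c = crit_integral a\<^sub>c \<rho>\<^sub>c)"

definition curve_sides :: "(real \<Rightarrow> real) \<Rightarrow> real \<Rightarrow> (real \<times> real) set set" where
  "curve_sides \<beta>cr \<rho>\<^sub>c =
     {{(r, b). 0 < r \<and> r < \<rho>\<^sub>c \<and> 0 < b \<and> b < \<beta>cr r},
      {(r, b). 0 < r \<and> r < \<rho>\<^sub>c \<and> \<beta>cr r < b}}"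

text \<open>\<open>S\<close> is the side of the curve on which the unique maximizer tends to \<open>d\<close>
  as the point \<open>(\<rho>, \<beta>cr \<rho>)\<close> is approached.\<close>

definition is_phase ::
  "(real \<Rightarrow> real) \<Rightarrow> real \<Rightarrow> real \<Rightarrow> real \<Rightarrow> (real \<times> real) set \<Rightarrow> bool" where
  "is_phase \<beta>cr \<rho>\<^sub>c \<rho> d S \<longleftrightarrow> S \<in> curve_sides \<beta>cr \<rho>\<^sub>c \<and>
     ((\<lambda>(r, b). optimal_d r b) \<longlongrightarrow> d) (at (\<rho>, \<beta>cr \<rho>) within S)"

text \<open>The partial derivatives are required to exist throughout each phase, so that \<open>deriv\<close>
  is meaningful there.\<close>

definition d_rho_limit ::
  "(real \<Rightarrow> real \<Rightarrow> real) \<Rightarrow> (real \<Rightarrow> real) \<Rightarrow> real \<Rightarrow> real \<Rightarrow> real \<Rightarrow> real \<Rightarrow> bool" where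
  "d_rho_limit lam \<beta>cr \<rho>\<^sub>c \<rho> d L \<longleftrightarrow> (\<exists>S. is_phase \<beta>cr \<rho>\<^sub>c \<rho> d S \<and>
     (\<forall>(r, b) \<in> S. (\<lambda>x. lam x b) differentiable (at r)) \<and>
     ((\<lambda>(r, b). deriv (\<lambda>x. lam x b) r) \<longlongrightarrow> L) (at (\<rho>, \<beta>cr \<rho>) within S))"

definition d_beta_limit ::
  "(real \<Rightarrow> real \<Rightarrow> real) \<Rightarrow> (real \<Rightarrow> real) \<Rightarrow> real \<Rightarrow> real \<Rightarrow> real \<Rightarrow> real \<Rightarrow> bool" where
  "d_beta_limit lam \<beta>cr \<rho>\<^sub>c \<rho> d L \<longleftrightarrow> (\<exists>S. is_phase \<beta>cr \<rho>\<^sub>c \<rho> d S \<and>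
     (\<forall>(r, b) \<in> S. (\<lambda>x. lam r x) differentiable (at b)) \<and>
     ((\<lambda>(r, b). deriv (\<lambda>x. lam r x) b) \<longlongrightarrow> L) (at (\<rho>, \<beta>cr \<rho>) within S))"

end

theory Submission
  imports Defs
begin

text \<open>
  The moments \<open>E[x\<^sub>i s\<^sub>i^k]\<close>, with \<open>s\<^sub>i\<close> the geometric Brownian motion at time \<open>i \<tau>\<close>, satisfy a closed
  linear recursion in \<open>i\<close> and \<open>k\<close>. Its solution is a sum over lattice paths of slope 0 or 1 with
  weight \<open>\<rho>\<close> per step up and \<open>exp (\<beta> K\<^sup>2)\<close> at scaled height \<open>K\<close>. Hence the Lyapunov exponent is the
  supremum over paths \<open>K\<close> from 0 of \<open>\<integral> (H(K') + K' ln \<rho> + \<beta> K\<^sup>2)\<close>, with \<open>H\<close> the binary entropy. With the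
  momentum given by conservation of energy, a path ending at \<open>d\<close> has value at most \<open>\<Lambda>(d)\<close>, and the
  bound is attained if the extremal path needs exactly unit time to reach \<open>d\<close>, which is the
  condition \<open>\<Lambda>'(d) = 0\<close>.

  For a fixed path the functional is affine in \<open>(ln \<rho>, \<beta>)\<close>, so each maximizer \<open>d\<close> gives a subgradient
  \<open>(d, B)\<close> of the exponent, where \<open>B\<close> is the integral of \<open>K\<^sup>2\<close>. Together with compactness of the set
  of maximizers this yields all derivatives: \<open>d / \<rho>\<close> and \<open>B\<close> off the curve, and two expressions for
  the derivative along the curve, whose equality is the Clausius-Clapeyron relation, since
  \<open>B\<^sub>2 - B\<^sub>1 = (d\<^sub>2\<^sup>2 - d\<^sub>1\<^sup>2) / 2\<close>. The limit point of the curve does not belong to it, so the maximizer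
  there is unique and both solutions converge to it.
\<close>

section \<open>Energy and momentum of extremal paths\<close>

text \<open>Paths ending at \<open>d\<close> are parametrized by the relative height \<open>y = K / d\<close>: \<open>drift\<close> is the slope \<open>K'\<close> of the
  extremal path at height \<open>d * y\<close>, \<open>momentum\<close> the conjugate momentum, \<open>transit_time\<close> the time needed to
  reach \<open>d\<close>, and \<open>second_moment\<close> the integral of \<open>K\<^sup>2\<close> over that time.\<close>

definition drift :: "real \<Rightarrow> real \<Rightarrow> real \<Rightarrow> real \<Rightarrow> real" where
  "drift \<rho> \<beta> d y = 1 - exp (\<beta> * d\<^sup>2 * (y\<^sup>2 - 1)) / (1 + \<rho>)"

definition momentum :: "real \<Rightarrow> real \<Rightarrow> real \<Rightarrow> real \<Rightarrow> real" where
  "momentum \<rho> \<beta> d y = ln (drift \<rho> \<beta> d y) + \<beta> * d\<^sup>2 * (1 - y\<^sup>2) + ln (1 + \<rho>) - ln \<rho>"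

definition transit_time :: "real \<Rightarrow> real \<Rightarrow> real \<Rightarrow> real" where
  "transit_time \<rho> \<beta> d = d * integral {0..1} (\<lambda>y. 1 / drift \<rho> \<beta> d y)"

definition second_moment :: "real \<Rightarrow> real \<Rightarrow> real \<Rightarrow> real" where
  "second_moment \<rho> \<beta> d = d ^ 3 * integral {0..1} (\<lambda>y. y\<^sup>2 / drift \<rho> \<beta> d y)"

text \<open>The drift falls with the height, and its value at the endpoint \<open>y = 1\<close>
  depends neither on \<open>\<beta>\<close> nor on \<open>d\<close>. This bound keeps every
  integrand with \<open>drift\<close> in the denominator regular on the closed interval.\<close>

lemma drift_ge:
  assumes "0 < \<rho>" "0 \<le> \<beta>" "y \<in> {0..1}"
  shows "\<rho> / (1 + \<rho>) \<le> drift \<rho> \<beta> d y"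
proof -
  have "y\<^sup>2 \<le> 1"
    using assms by (simp add: power_le_one)
  then have "\<beta> * d\<^sup>2 * (y\<^sup>2 - 1) \<le> 0"
    using assms by (intro mult_nonneg_nonpos) auto
  then have "exp (\<beta> * d\<^sup>2 * (y\<^sup>2 - 1)) / (1 + \<rho>) \<le> 1 / (1 + \<rho>)"
    using assms by (intro divide_right_mono) auto
  moreover have "\<rho> / (1 + \<rho>) = 1 - 1 / (1 + \<rho>)"
    using assms by (simp add: field_simps)
  ultimately show ?thesis
    by (simp add: drift_def)
qed

lemma drift_pos:
  assumes "0 < \<rho>" "0 \<le> \<beta>" "y \<in> {0..1}"
  shows "0 < drift \<rho> \<beta> d y"
  using drift_ge[OF assms, of d] assms
  by (smt (verit) divide_pos_pos)

lemma drift_nonzero: "0 < \<rho> \<Longrightarrow> 0 \<le> \<beta> \<Longrightarrow> 0 \<le> y \<Longrightarrow> y \<le> 1 \<Longrightarrow> drift \<rho> \<beta> d y \<noteq> 0"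
  using drift_pos[of \<rho> \<beta> y d] by auto

lemma drift_less_1: "0 < \<rho> \<Longrightarrow> drift \<rho> \<beta> d y < 1"
  by (simp add: drift_def add_pos_pos)

lemma drift_antimono:
  assumes "0 < \<rho>" "0 \<le> \<beta>" "0 \<le> x" "x \<le> y"
  shows "drift \<rho> \<beta> d y \<le> drift \<rho> \<beta> d x"
proof -
  have "\<beta> * d\<^sup>2 * (x\<^sup>2 - 1) \<le> \<beta> * d\<^sup>2 * (y\<^sup>2 - 1)"
    using assms by (intro mult_left_mono) (auto intro: power_mono)
  then show ?thesis
    using assms by (simp add: drift_def divide_right_mono)
qed

lemma drift_1: "0 < \<rho> \<Longrightarrow> drift \<rho> \<beta> d 1 = \<rho> / (1 + \<rho>)"
  by (simp add: drift_def field_simps)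

text \<open>Transversality: the endpoint of the path is free, so the conjugate momentum vanishes
  there.\<close>

lemma momentum_1: "0 < \<rho> \<Longrightarrow> momentum \<rho> \<beta> d 1 = 0"
  by (simp add: momentum_def drift_1 ln_div)

lemma momentum_antimono:
  assumes "0 < \<rho>" "0 \<le> \<beta>" "0 \<le> x" "x \<le> y" "y \<le> 1"
  shows "momentum \<rho> \<beta> d y \<le> momentum \<rho> \<beta> d x"
proof -
  have "ln (drift \<rho> \<beta> d y) \<le> ln (drift \<rho> \<beta> d x)"
    using assms by (intro ln_mono drift_antimono drift_pos) auto
  moreover have "\<beta> * d\<^sup>2 * (1 - y\<^sup>2) \<le> \<beta> * d\<^sup>2 * (1 - x\<^sup>2)"
    using assms by (intro mult_left_mono) (auto intro: power_mono)
  ultimately show ?thesis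
    by (simp add: momentum_def)
qed

text \<open>In logarithms, the Hamiltonian
  \<open>ln (1 + \<rho> * exp p) + \<beta> * K\<^sup>2\<close> keeps its value at the endpoint,
  where the momentum is zero; \<open>momentum\<close> is this equation solved for \<open>p\<close>.
  The exponential form is the one-step relation needed for path sums.\<close>

lemma energy_conservation:
  assumes "0 < \<rho>" "0 \<le> \<beta>" "y \<in> {0..1}"
  shows "exp (\<beta> * (d * y)\<^sup>2) * (1 + \<rho> * exp (momentum \<rho> \<beta> d y)) = exp (\<beta> * d\<^sup>2 + ln (1 + \<rho>))"
proof -
  have "exp (momentum \<rho> \<beta> d y) = drift \<rho> \<beta> d y * exp (\<beta> * d\<^sup>2 * (1 - y\<^sup>2)) * (1 + \<rho>) / \<rho>"
    using assms drift_pos[OF assms, of d] by (simp add: momentum_def exp_add exp_diff)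
  then have "1 + \<rho> * exp (momentum \<rho> \<beta> d y) =
      1 + drift \<rho> \<beta> d y * exp (\<beta> * d\<^sup>2 * (1 - y\<^sup>2)) * (1 + \<rho>)"
    using assms by simp
  also have "drift \<rho> \<beta> d y * exp (\<beta> * d\<^sup>2 * (1 - y\<^sup>2)) * (1 + \<rho>) =
      (1 + \<rho>) * exp (\<beta> * d\<^sup>2 * (1 - y\<^sup>2)) - exp (\<beta> * d\<^sup>2 * (y\<^sup>2 - 1) + \<beta> * d\<^sup>2 * (1 - y\<^sup>2))"
    using assms unfolding exp_add by (simp add: drift_def field_simps)
  also have "\<beta> * d\<^sup>2 * (y\<^sup>2 - 1) + \<beta> * d\<^sup>2 * (1 - y\<^sup>2) = 0"
    by (simp add: algebra_simps)
  finally have "1 + \<rho> * exp (momentum \<rho> \<beta> d y) = (1 + \<rho>) * exp (\<beta> * d\<^sup>2 * (1 - y\<^sup>2))"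
    by simp
  moreover have "exp (\<beta> * d\<^sup>2) = exp (\<beta> * (d * y)\<^sup>2 + \<beta> * d\<^sup>2 * (1 - y\<^sup>2))"
    by (simp add: algebra_simps power_mult_distrib)
  ultimately show ?thesis
    using assms by (simp add: exp_add del: exp_le_cancel_iff)
qed

definition binary_entropy :: "real \<Rightarrow> real" where
  "binary_entropy g = - g * ln g - (1 - g) * ln (1 - g)"

text \<open>Legendre duality: on the extremal path the Lagrangian is the conserved energy minus
  momentum times velocity. Since \<open>1 - drift\<close> is a pure exponential, its logarithm is
  explicit.\<close>

lemma binary_entropy_drift:
  assumes "0 < \<rho>" "0 \<le> \<beta>" "y \<in> {0..1}"
  shows "binary_entropy (drift \<rho> \<beta> d y) + drift \<rho> \<beta> d y * ln \<rho> + \<beta> * (d * y)\<^sup>2 =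
    \<beta> * d\<^sup>2 + ln (1 + \<rho>) - drift \<rho> \<beta> d y * momentum \<rho> \<beta> d y"
proof -
  have "1 - drift \<rho> \<beta> d y = exp (\<beta> * d\<^sup>2 * (y\<^sup>2 - 1)) / (1 + \<rho>)"
    by (simp add: drift_def)
  then have *: "ln (1 - drift \<rho> \<beta> d y) = \<beta> * d\<^sup>2 * (y\<^sup>2 - 1) - ln (1 + \<rho>)"
    using assms by (simp add: ln_div)
  show ?thesis
    unfolding binary_entropy_def * momentum_def by (simp add: algebra_simps power_mult_distrib)
qed

lemma continuous_on_drift [continuous_intros]:
  assumes "continuous_on S r" "continuous_on S b" "continuous_on S d" "continuous_on S y"
    and "\<And>x. x \<in> S \<Longrightarrow> 0 < r x"
  shows "continuous_on S (\<lambda>x. drift (r x) (b x) (d x) (y x))"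
  unfolding drift_def using assms(5) by (intro continuous_intros assms(1-4)) (auto simp: add_pos_pos less_imp_neq[symmetric])

lemma continuous_on_momentum [continuous_intros]:
  assumes "continuous_on S r" "continuous_on S b" "continuous_on S d" "continuous_on S y"
    and "\<And>x. x \<in> S \<Longrightarrow> 0 < r x" "\<And>x. x \<in> S \<Longrightarrow> 0 \<le> b x" "\<And>x. x \<in> S \<Longrightarrow> y x \<in> {0..1}"
  shows "continuous_on S (\<lambda>x. momentum (r x) (b x) (d x) (y x))"
  unfolding momentum_def using assms(5-7)
  by (intro continuous_intros assms(1-5)) (auto simp: drift_nonzero add_pos_pos less_imp_neq[symmetric])

lemma inverse_drift_integrable:
  assumes "0 < \<rho>" "0 \<le> \<beta>" "0 \<le> a" "b \<le> 1" "continuous_on {a..b} f"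
  shows "(\<lambda>y. f y / drift \<rho> \<beta> d y) integrable_on {a..b}"
  using assms by (intro integrable_continuous_real continuous_intros) (auto simp: drift_nonzero)

lemma momentum_integrable:
  assumes "0 < \<rho>" "0 \<le> \<beta>" "0 \<le> a" "b \<le> 1"
  shows "momentum \<rho> \<beta> d integrable_on {a..b}"
  using assms by (intro integrable_continuous_real continuous_intros) auto

lemma drift_has_derivative:
  "(drift \<rho> \<beta> d has_real_derivative - (1 - drift \<rho> \<beta> d y) * (2 * \<beta> * d\<^sup>2 * y)) (at y within S)"
proof -
  have "((\<lambda>y. 1 - exp (\<beta> * d\<^sup>2 * (y\<^sup>2 - 1)) * inverse (1 + \<rho>)) has_real_derivative
      - (exp (\<beta> * d\<^sup>2 * (y\<^sup>2 - 1)) * inverse (1 + \<rho>) * (2 * \<beta> * d\<^sup>2 * y))) (at y within S)"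
    by (rule derivative_eq_intros refl | simp)+
  then show ?thesis
    by (simp add: drift_def[abs_def] divide_inverse)
qed

lemma drift_has_derivative_d:
  "((\<lambda>d. drift \<rho> \<beta> d y) has_real_derivative (1 - drift \<rho> \<beta> d y) * (2 * \<beta> * d * (1 - y\<^sup>2)))
     (at d within S)"
proof -
  have "((\<lambda>d. 1 - exp (\<beta> * d\<^sup>2 * (y\<^sup>2 - 1)) * inverse (1 + \<rho>)) has_real_derivative
      exp (\<beta> * d\<^sup>2 * (y\<^sup>2 - 1)) * inverse (1 + \<rho>) * (2 * \<beta> * d * (1 - y\<^sup>2))) (at d within S)"
    by (rule derivative_eq_intros refl | simp add: algebra_simps)+
  then show ?thesis
    by (simp add: drift_def[abs_def] divide_inverse)
qed

lemma momentum_has_derivative: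
  assumes "0 < \<rho>" "0 \<le> \<beta>" "y \<in> {0..1}"
  shows "(momentum \<rho> \<beta> d has_real_derivative - 2 * \<beta> * d\<^sup>2 * (y / drift \<rho> \<beta> d y)) (at y within S)"
proof -
  have "((\<lambda>y. ln (drift \<rho> \<beta> d y) + \<beta> * d\<^sup>2 * (1 - y\<^sup>2) + ln (1 + \<rho>) - ln \<rho>) has_real_derivative
     (- (1 - drift \<rho> \<beta> d y) * (2 * \<beta> * d\<^sup>2 * y)) / drift \<rho> \<beta> d y + \<beta> * d\<^sup>2 * (- (2 * y))) (at y within S)"
    using drift_pos[OF assms, of d]
    by (auto intro!: derivative_eq_intros drift_has_derivative simp: field_simps)
  also have "(- (1 - drift \<rho> \<beta> d y) * (2 * \<beta> * d\<^sup>2 * y)) / drift \<rho> \<beta> d y + \<beta> * d\<^sup>2 * (- (2 * y)) =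
      - 2 * \<beta> * d\<^sup>2 * (y / drift \<rho> \<beta> d y)"
    using drift_pos[OF assms, of d] by (simp add: field_simps)
  finally show ?thesis
    unfolding momentum_def .
qed

lemma momentum_has_derivative_d:
  assumes "0 < \<rho>" "0 \<le> \<beta>" "y \<in> {0..1}"
  shows "((\<lambda>d. momentum \<rho> \<beta> d y) has_real_derivative 2 * \<beta> * d * ((1 - y\<^sup>2) / drift \<rho> \<beta> d y))
    (at d within S)"
proof -
  have "((\<lambda>d. ln (drift \<rho> \<beta> d y) + \<beta> * d\<^sup>2 * (1 - y\<^sup>2) + ln (1 + \<rho>) - ln \<rho>) has_real_derivative
     ((1 - drift \<rho> \<beta> d y) * (2 * \<beta> * d * (1 - y\<^sup>2))) / drift \<rho> \<beta> d y + \<beta> * (2 * d) * (1 - y\<^sup>2)) (at d within S)"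
    using drift_pos[OF assms, of d]
    by (auto intro!: derivative_eq_intros drift_has_derivative_d simp: field_simps)
  also have "((1 - drift \<rho> \<beta> d y) * (2 * \<beta> * d * (1 - y\<^sup>2))) / drift \<rho> \<beta> d y + \<beta> * (2 * d) * (1 - y\<^sup>2) =
      2 * \<beta> * d * ((1 - y\<^sup>2) / drift \<rho> \<beta> d y)"
    using drift_pos[OF assms, of d] by (simp add: field_simps)
  finally show ?thesis
    unfolding momentum_def .
qed

section \<open>The functional \<open>Lambda\<close> and its derivative\<close>

lemma Lambda_second_moment:
  assumes "0 < \<rho>"
  shows "Lambda \<rho> \<beta> d = \<beta> * d\<^sup>2 + ln (1 + \<rho>) - 2 * \<beta> * second_moment \<rho> \<beta> d"
proof -
  have "y\<^sup>2 / drift \<rho> \<beta> d y = (1 + \<rho>) * (y\<^sup>2 / (1 + \<rho> - exp (\<beta> * d\<^sup>2 * (y\<^sup>2 - 1))))" for y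
  proof -
    have "drift \<rho> \<beta> d y = (1 + \<rho> - exp (\<beta> * d\<^sup>2 * (y\<^sup>2 - 1))) / (1 + \<rho>)"
      using assms by (simp add: drift_def field_simps)
    then show ?thesis by simp
  qed
  then have "second_moment \<rho> \<beta> d =
      d ^ 3 * ((1 + \<rho>) * integral {0..1} (\<lambda>y. y\<^sup>2 / (1 + \<rho> - exp (\<beta> * d\<^sup>2 * (y\<^sup>2 - 1)))))"
    by (simp only: second_moment_def integral_mult_right)
  then show ?thesis
    by (simp only: Lambda_def mult_ac)
qed

text \<open>Integration by parts; the boundary term vanishes because \<open>momentum\<close> is zero at \<open>y = 1\<close>.\<close>

lemma integral_momentum:
  assumes "0 < \<rho>" "0 \<le> \<beta>"
  shows "integral {0..1} (momentum \<rho> \<beta> d) =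
    2 * \<beta> * d\<^sup>2 * integral {0..1} (\<lambda>y. y\<^sup>2 / drift \<rho> \<beta> d y)"
proof -
  have "((\<lambda>y. momentum \<rho> \<beta> d y - 2 * \<beta> * d\<^sup>2 * (y\<^sup>2 / drift \<rho> \<beta> d y)) has_integral
      1 * momentum \<rho> \<beta> d 1 - 0 * momentum \<rho> \<beta> d 0) {0..1}"
  proof (intro fundamental_theorem_of_calculus)
    fix y :: real assume y: "y \<in> {0..1}"
    have "((\<lambda>y. y * momentum \<rho> \<beta> d y) has_real_derivative
      momentum \<rho> \<beta> d y - 2 * \<beta> * d\<^sup>2 * (y\<^sup>2 / drift \<rho> \<beta> d y)) (at y within {0..1})"
      using momentum_has_derivative[OF assms y]
      by (auto intro!: derivative_eq_intros simp: power2_eq_square)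
    then show "((\<lambda>y. y * momentum \<rho> \<beta> d y) has_vector_derivative
      momentum \<rho> \<beta> d y - 2 * \<beta> * d\<^sup>2 * (y\<^sup>2 / drift \<rho> \<beta> d y)) (at y within {0..1})"
      by (simp add: has_real_derivative_iff_has_vector_derivative)
  qed simp
  then have "integral {0..1} (\<lambda>y. momentum \<rho> \<beta> d y - 2 * \<beta> * d\<^sup>2 * (y\<^sup>2 / drift \<rho> \<beta> d y)) = 0"
    using assms by (simp add: integral_unique momentum_1)
  moreover have "(\<lambda>y. 2 * \<beta> * d\<^sup>2 * (y\<^sup>2 / drift \<rho> \<beta> d y)) integrable_on {0..1}"
    using assms
    by (intro integrable_on_mult_right inverse_drift_integrable continuous_intros) auto
  ultimately show ?thesis
    using assms
    by (subst (asm) integral_diff) (simp_all add: momentum_integrable del: times_divide_eq_right)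
qed

text \<open>The action of the path as energy minus the integral of momentum over height, which is
  the form that both path-sum bounds produce.\<close>

lemma Lambda_momentum:
  assumes "0 < \<rho>" "0 \<le> \<beta>"
  shows "Lambda \<rho> \<beta> d = \<beta> * d\<^sup>2 + ln (1 + \<rho>) - d * integral {0..1} (momentum \<rho> \<beta> d)"
  using assms
  by (simp add: Lambda_second_moment second_moment_def integral_momentum power3_eq_cube power2_eq_square)

text \<open>After differentiation under the integral, the part with \<open>y\<^sup>2\<close> cancels
  against \<open>integral_momentum\<close> and only the integral of \<open>1 / drift\<close>
  survives. For \<open>\<beta> > 0\<close> a critical point \<open>d > 0\<close> is thus a height
  reached in exactly unit time.\<close>

lemma Lambda_has_derivative:
  assumes "0 < \<rho>" "0 \<le> \<beta>"
  shows "(Lambda \<rho> \<beta> has_real_derivative 2 * \<beta> * d * (1 - transit_time \<rho> \<beta> d)) (at d)"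
proof -
  have "((\<lambda>d. integral (cbox 0 1) (momentum \<rho> \<beta> d)) has_field_derivative
     integral (cbox 0 1) (\<lambda>y. 2 * \<beta> * d * ((1 - y\<^sup>2) / drift \<rho> \<beta> d y))) (at d)"
  proof (rule leibniz_rule_field_derivative)
    show "continuous_on (UNIV \<times> cbox 0 1) (\<lambda>(d, y). 2 * \<beta> * d * ((1 - y\<^sup>2) / drift \<rho> \<beta> d y))"
      using assms unfolding case_prod_unfold
      by (intro continuous_intros) (auto simp: drift_nonzero)
    show "momentum \<rho> \<beta> d integrable_on cbox 0 1" for d
      using momentum_integrable[OF assms, of 0 1] by simp
  qed (use momentum_has_derivative_d[OF assms] in auto)
  then have *: "((\<lambda>d. integral {0..1} (momentum \<rho> \<beta> d)) has_field_derivative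
     2 * \<beta> * d * integral {0..1} (\<lambda>y. (1 - y\<^sup>2) / drift \<rho> \<beta> d y)) (at d)"
    by (simp del: times_divide_eq_right)
  have split: "integral {0..1} (\<lambda>y. (1 - y\<^sup>2) / drift \<rho> \<beta> d y) =
      integral {0..1} (\<lambda>y. 1 / drift \<rho> \<beta> d y) - integral {0..1} (\<lambda>y. y\<^sup>2 / drift \<rho> \<beta> d y)"
    unfolding diff_divide_distrib using assms
    by (intro integral_diff inverse_drift_integrable continuous_intros) auto
  have "2 * \<beta> * d - (integral {0..1} (momentum \<rho> \<beta> d) +
      d * (2 * \<beta> * d * integral {0..1} (\<lambda>y. (1 - y\<^sup>2) / drift \<rho> \<beta> d y))) =
      2 * \<beta> * d * (1 - transit_time \<rho> \<beta> d)"
    unfolding integral_momentum[OF assms] transit_time_def split power2_eq_square[of d]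
    by (simp only: algebra_simps)
  moreover have "((\<lambda>d. \<beta> * d\<^sup>2 + ln (1 + \<rho>) - d * integral {0..1} (momentum \<rho> \<beta> d)) has_real_derivative
     2 * \<beta> * d - (integral {0..1} (momentum \<rho> \<beta> d) +
      d * (2 * \<beta> * d * integral {0..1} (\<lambda>y. (1 - y\<^sup>2) / drift \<rho> \<beta> d y)))) (at d)"
    using * by (auto intro!: derivative_eq_intros)
  ultimately show ?thesis
    unfolding Lambda_momentum[OF assms, abs_def] by simp
qed

text \<open>The slope is at least its endpoint value. This bound and the lower bound in
  \<open>transit_time_gt\<close> fix the sign of the derivative of \<open>Lambda\<close> near 0 and
  at 1.\<close>

lemma transit_time_le:
  assumes "0 < \<rho>" "0 \<le> \<beta>" "0 \<le> d"
  shows "transit_time \<rho> \<beta> d \<le> d * ((1 + \<rho>) / \<rho>)"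
proof -
  have "integral {0..1} (\<lambda>y. 1 / drift \<rho> \<beta> d y) \<le> integral {0..1} (\<lambda>y::real. (1 + \<rho>) / \<rho>)"
  proof (rule integral_le)
    show "1 / drift \<rho> \<beta> d y \<le> (1 + \<rho>) / \<rho>" if "y \<in> {0..1}" for y
      using drift_ge[OF assms(1,2) that, of d] assms drift_pos[OF assms(1,2) that, of d]
      by (simp add: field_simps)
  qed (use assms in \<open>auto intro!: inverse_drift_integrable continuous_intros\<close>)
  then show ?thesis
    using assms unfolding transit_time_def by (intro mult_left_mono) auto
qed

lemma transit_time_gt:
  assumes "0 < \<rho>" "0 \<le> \<beta>" "0 < d"
  shows "d < transit_time \<rho> \<beta> d"
proof -
  \<comment> \<open>The drift is largest at height 0 and below 1 even there, so this constant gives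
    a strict inequality.\<close>
  define c where "c = 1 / drift \<rho> \<beta> d 0"
  have "integral {0..1} (\<lambda>y::real. c) \<le> integral {0..1} (\<lambda>y. 1 / drift \<rho> \<beta> d y)"
  proof (rule integral_le)
    show "c \<le> 1 / drift \<rho> \<beta> d y" if "y \<in> {0..1}" for y
      unfolding c_def using drift_antimono[OF assms(1,2), of 0 y d] that
        drift_pos[OF assms(1,2) that, of d] by (auto intro!: divide_left_mono)
  qed (use assms in \<open>auto intro!: inverse_drift_integrable continuous_intros\<close>)
  moreover have "1 < c"
    unfolding c_def using drift_less_1[of \<rho> \<beta> d 0] drift_pos[of \<rho> \<beta> 0 d] assms
    by (simp add: field_simps)
  ultimately show ?thesis
    using assms unfolding transit_time_def by (simp add: mult_less_cancel_left1)
qed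

lemma continuous_on_second_moment:
  "continuous_on {(r, b, d). 0 < r \<and> 0 < b} (\<lambda>(r, b, d). second_moment r b d)"
proof -
  have "continuous_on {(r::real, b::real, d::real). 0 < r \<and> 0 < b}
     (\<lambda>x. integral (cbox 0 1) (\<lambda>y. y\<^sup>2 / drift (fst x) (fst (snd x)) (snd (snd x)) y))"
  proof (rule integral_continuous_on_param)
    show "continuous_on ({(r, b, d). 0 < r \<and> 0 < b} \<times> cbox 0 1)
     (\<lambda>(x, y). y\<^sup>2 / drift (fst x) (fst (snd x)) (snd (snd x)) y)"
      unfolding case_prod_unfold
      by (intro continuous_intros) (auto simp: drift_nonzero)
  qed
  then show ?thesis
    unfolding second_moment_def case_prod_unfold by (intro continuous_intros) auto
qed

lemma tendsto_second_moment:
  assumes "(r \<longlongrightarrow> r0) F" "(b \<longlongrightarrow> b0) F" "(d \<longlongrightarrow> d0) F" "0 < r0" "0 < b0"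
  shows "((\<lambda>t. second_moment (r t) (b t) (d t)) \<longlongrightarrow> second_moment r0 b0 d0) F"
proof -
  have "{(r::real, b::real, d::real). 0 < r \<and> 0 < b} = {0<..} \<times> {0<..} \<times> UNIV"
    by auto
  then have "open {(r::real, b::real, d::real). 0 < r \<and> 0 < b}"
    by (simp add: open_Times)
  then have "isCont (\<lambda>(r, b, d). second_moment r b d) (r0, b0, d0)"
    using continuous_on_second_moment assms(4,5) by (auto simp: continuous_on_eq_continuous_at)
  moreover have "((\<lambda>t. (r t, b t, d t)) \<longlongrightarrow> (r0, b0, d0)) F"
    using assms by (intro tendsto_Pair)
  ultimately show ?thesis
    by (auto dest: isCont_tendsto_compose)
qed

lemma tendsto_Lambda:
  assumes "(r \<longlongrightarrow> r0) F" "(b \<longlongrightarrow> b0) F" "(d \<longlongrightarrow> d0) F" "0 < r0" "0 < b0"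
  shows "((\<lambda>t. Lambda (r t) (b t) (d t)) \<longlongrightarrow> Lambda r0 b0 d0) F"
proof (rule Lim_transform_eventually)
  show "((\<lambda>t. b t * (d t)\<^sup>2 + ln (1 + r t) - 2 * b t * second_moment (r t) (b t) (d t))
     \<longlongrightarrow> Lambda r0 b0 d0) F"
    unfolding Lambda_second_moment[OF assms(4)]
    using assms by (intro tendsto_intros tendsto_second_moment) auto
  have "eventually (\<lambda>t. 0 < r t) F"
    using assms(1,4) by (rule order_tendstoD)
  then show "\<forall>\<^sub>F t in F. b t * (d t)\<^sup>2 + ln (1 + r t) - 2 * b t * second_moment (r t) (b t) (d t) =
      Lambda (r t) (b t) (d t)"
    by eventually_elim (simp add: Lambda_second_moment)
qed

section \<open>Maximizers\<close>

text \<open>The derivative of \<open>Lambda\<close> is positive just right of 0, where the transit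
  time is short, and negative at 1, where it exceeds 1; hence the maximum over the closed interval
  is not at an end. The last conclusion passes this on to every point that does at least as
  well.\<close>

lemma Lambda_maximizer_exists:
  assumes "0 < \<rho>" "0 < \<beta>"
  obtains d where "0 < d" "d < 1" "\<And>e. 0 \<le> e \<Longrightarrow> e \<le> 1 \<Longrightarrow> Lambda \<rho> \<beta> e \<le> Lambda \<rho> \<beta> d"
    "\<And>d'. 0 \<le> d' \<Longrightarrow> d' \<le> 1 \<Longrightarrow> Lambda \<rho> \<beta> d \<le> Lambda \<rho> \<beta> d' \<Longrightarrow> 0 < d' \<and> d' < 1"
proof -
  have der: "(Lambda \<rho> \<beta> has_real_derivative 2 * \<beta> * d * (1 - transit_time \<rho> \<beta> d)) (at d)" for d
    using assms by (intro Lambda_has_derivative) auto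
  have "continuous_on {0..1} (Lambda \<rho> \<beta>)"
    using der by (intro DERIV_continuous_on[of _ _ "\<lambda>d. 2 * \<beta> * d * (1 - transit_time \<rho> \<beta> d)"])
      (auto intro: has_field_derivative_at_within)
  then obtain d where d: "d \<in> {0..1}" "\<And>e. e \<in> {0..1} \<Longrightarrow> Lambda \<rho> \<beta> e \<le> Lambda \<rho> \<beta> d"
    using continuous_attains_sup[of "{0..1::real}" "Lambda \<rho> \<beta>"] by auto
  \<comment> \<open>Half of the height at which the bound of \<open>transit_time_le\<close> reaches
    1.\<close>
  define e where "e = \<rho> / (2 * (1 + \<rho>))"
  have e: "0 < e" "e \<le> 1"
    using assms by (auto simp: e_def field_simps)
  have "\<exists>z. 0 < z \<and> z < e \<and> Lambda \<rho> \<beta> e - Lambda \<rho> \<beta> 0 = (e - 0) * (2 * \<beta> * z * (1 - transit_time \<rho> \<beta> z))"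
    using e der by (intro MVT2) auto
  then obtain z where z: "0 < z" "z < e"
    "Lambda \<rho> \<beta> e - Lambda \<rho> \<beta> 0 = e * (2 * \<beta> * z * (1 - transit_time \<rho> \<beta> z))"
    by auto
  have "transit_time \<rho> \<beta> z \<le> z * ((1 + \<rho>) / \<rho>)"
    using assms z by (intro transit_time_le) auto
  also have "\<dots> < e * ((1 + \<rho>) / \<rho>)"
    using assms z by (intro mult_strict_right_mono) auto
  also have "\<dots> < 1"
    using assms by (simp add: e_def)
  finally have "0 < e * (2 * \<beta> * z * (1 - transit_time \<rho> \<beta> z))"
    using assms e z by (intro mult_pos_pos) auto
  then have lt0: "Lambda \<rho> \<beta> 0 < Lambda \<rho> \<beta> e"
    using z(3) by linarith
  have "2 * \<beta> * 1 * (1 - transit_time \<rho> \<beta> 1) < 0"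
    using transit_time_gt[of \<rho> \<beta> 1] assms by (intro mult_pos_neg) auto
  from DERIV_neg_dec_left[OF der this] obtain h where h: "h > 0"
    "\<And>k. 0 < k \<Longrightarrow> k < h \<Longrightarrow> Lambda \<rho> \<beta> 1 < Lambda \<rho> \<beta> (1 - k)"
    by auto
  define k where "k = min (h / 2) (1 / 2)"
  have lt1: "Lambda \<rho> \<beta> 1 < Lambda \<rho> \<beta> (1 - k)" "1 - k \<in> {0..1}"
    using h by (auto simp: k_def min_def)
  have interior: "0 < d' \<and> d' < 1" if "0 \<le> d'" "d' \<le> 1" "Lambda \<rho> \<beta> d \<le> Lambda \<rho> \<beta> d'" for d'
    using that lt0 lt1 d(2)[of e] d(2)[of "1 - k"] e
    by (cases "d' = 0"; cases "d' = 1") auto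
  show thesis
    using that[of d] d interior[of d] interior by auto
qed

lemma variational_solutions_nonempty:
  assumes "0 < \<rho>" "0 < \<beta>"
  shows "variational_solutions \<rho> \<beta> \<noteq> {}"
  using Lambda_maximizer_exists[OF assms] unfolding variational_solutions_def
  by (smt (verit) empty_iff greaterThanLessThan_iff mem_Collect_eq)

text \<open>The ends are never maximal, so the open interval may be replaced by the compact one, the
  form needed for limits.\<close>

lemma variational_solutions_iff:
  assumes "0 < \<rho>" "0 < \<beta>"
  shows "d \<in> variational_solutions \<rho> \<beta> \<longleftrightarrow> d \<in> {0..1} \<and> (\<forall>e \<in> {0..1}. Lambda \<rho> \<beta> e \<le> Lambda \<rho> \<beta> d)"
proof -
  obtain d0 where d0: "0 < d0" "d0 < 1" "\<And>e. 0 \<le> e \<Longrightarrow> e \<le> 1 \<Longrightarrow> Lambda \<rho> \<beta> e \<le> Lambda \<rho> \<beta> d0"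
    "\<And>d'. 0 \<le> d' \<Longrightarrow> d' \<le> 1 \<Longrightarrow> Lambda \<rho> \<beta> d0 \<le> Lambda \<rho> \<beta> d' \<Longrightarrow> 0 < d' \<and> d' < 1"
    using Lambda_maximizer_exists[OF assms] by metis
  show ?thesis
  proof
    assume d: "d \<in> variational_solutions \<rho> \<beta>"
    then have "Lambda \<rho> \<beta> d0 \<le> Lambda \<rho> \<beta> d" "d \<in> {0<..<1}"
      using d0 by (auto simp: variational_solutions_def)
    then show "d \<in> {0..1} \<and> (\<forall>e \<in> {0..1}. Lambda \<rho> \<beta> e \<le> Lambda \<rho> \<beta> d)"
      using d0(3) by force
  next
    assume d: "d \<in> {0..1} \<and> (\<forall>e \<in> {0..1}. Lambda \<rho> \<beta> e \<le> Lambda \<rho> \<beta> d)"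
    then have "0 < d \<and> d < 1"
      using d0 by auto
    with d show "d \<in> variational_solutions \<rho> \<beta>"
      by (auto simp: variational_solutions_def)
  qed
qed

text \<open>An interior maximum is critical, and the factor \<open>2 * \<beta> * d\<close> is
  nonzero. This lets the extremal path serve as a unit-time trial path.\<close>

lemma transit_time_variational_solution:
  assumes "0 < \<rho>" "0 < \<beta>" "d \<in> variational_solutions \<rho> \<beta>"
  shows "transit_time \<rho> \<beta> d = 1"
proof -
  have d: "0 < d" "d < 1" "\<And>e. 0 < e \<Longrightarrow> e < 1 \<Longrightarrow> Lambda \<rho> \<beta> e \<le> Lambda \<rho> \<beta> d"
    using assms by (auto simp: variational_solutions_def)
  have "2 * \<beta> * d * (1 - transit_time \<rho> \<beta> d) = 0"
  proof (rule DERIV_local_max[of "Lambda \<rho> \<beta>" _ _ "min d (1 - d)"])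
    show "\<forall>y. \<bar>d - y\<bar> < min d (1 - d) \<longrightarrow> Lambda \<rho> \<beta> y \<le> Lambda \<rho> \<beta> d"
      using d by (auto simp: abs_if split: if_splits)
  qed (use d assms Lambda_has_derivative in auto)
  then show ?thesis
    using d assms by auto
qed

section \<open>Stability of the set of maximizers\<close>

lemma closed_variational_solutions:
  assumes "r \<longlonglongrightarrow> r0" "b \<longlonglongrightarrow> b0" "d \<longlonglongrightarrow> d0" "0 < r0" "0 < b0"
    and "\<And>n :: nat. d n \<in> variational_solutions (r n) (b n)"
  shows "d0 \<in> variational_solutions r0 b0"
proof -
  have "eventually (\<lambda>n. 0 < r n) sequentially" "eventually (\<lambda>n. 0 < b n) sequentially"
    using assms by (auto intro: order_tendstoD)
  then have ev: "\<forall>\<^sub>F n in sequentially. d n \<in> {0..1} \<and> (\<forall>e\<in>{0..1}. Lambda (r n) (b n) e \<le> Lambda (r n) (b n) (d n))"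
    by eventually_elim (use assms(6) variational_solutions_iff in blast)
  have "d0 \<in> {0..1}"
    using assms(3) ev by (intro Lim_in_closed_set[of "{0..1}" d sequentially]) (auto elim: eventually_mono)
  moreover have "Lambda r0 b0 e \<le> Lambda r0 b0 d0" if "e \<in> {0..1}" for e
  proof (rule tendsto_le[OF sequentially_bot])
    show "(\<lambda>n. Lambda (r n) (b n) (d n)) \<longlonglongrightarrow> Lambda r0 b0 d0"
      "(\<lambda>n. Lambda (r n) (b n) e) \<longlonglongrightarrow> Lambda r0 b0 e"
      using assms by (auto intro: tendsto_Lambda)
    show "\<forall>\<^sub>F n in sequentially. Lambda (r n) (b n) e \<le> Lambda (r n) (b n) (d n)"
      using ev by eventually_elim (use that in blast)
  qed
  ultimately show ?thesis
    using assms by (simp add: variational_solutions_iff)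
qed

text \<open>One half of Berge's maximum theorem: maximizers escaping \<open>V\<close> along a
  sequence of parameters accumulate in the compact unit interval, and by the closed graph the
  accumulation point is a maximizer outside \<open>V\<close>.\<close>

lemma upper_hemicontinuous_variational_solutions:
  assumes "0 < r0" "0 < b0" "open V" "variational_solutions r0 b0 \<subseteq> V"
  shows "\<forall>\<^sub>F x in nhds (r0, b0). variational_solutions (fst x) (snd x) \<subseteq> V"
proof (rule ccontr)
  assume "\<not> ?thesis"
  then obtain x' where x': "x' \<longlonglongrightarrow> (r0, b0)"
    "\<not> (\<forall>\<^sub>F n in sequentially. variational_solutions (fst (x' n)) (snd (x' n)) \<subseteq> V)"
    by (auto simp: eventually_nhds_iff_sequentially)
  then obtain u :: "nat \<Rightarrow> nat" where u: "strict_mono u"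
    "\<And>n. \<not> variational_solutions (fst (x' (u n))) (snd (x' (u n))) \<subseteq> V"
    using not_eventually_sequentiallyD[OF x'(2)] by auto
  define x where "x = x' \<circ> u"
  have x: "x \<longlonglongrightarrow> (r0, b0)"
    "\<And>n. \<not> variational_solutions (fst (x n)) (snd (x n)) \<subseteq> V"
    using LIMSEQ_subseq_LIMSEQ[OF x'(1) u(1)] u(2) by (auto simp: x_def)
  then have "\<forall>n. \<exists>d. d \<in> variational_solutions (fst (x n)) (snd (x n)) \<and> d \<notin> V"
    by blast
  then obtain d where d: "\<And>n. d n \<in> variational_solutions (fst (x n)) (snd (x n))" "\<And>n. d n \<notin> V"
    by metis
  have "d n \<in> {0..1}" for n
    using d(1)[of n] by (auto simp: variational_solutions_def)
  then obtain d0 s where s: "strict_mono (s :: nat \<Rightarrow> nat)" "(d \<circ> s) \<longlonglongrightarrow> d0"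
    using compact_Icc[of 0 "1::real"] unfolding compact_def by meson
  have "(x \<circ> s) \<longlonglongrightarrow> (r0, b0)"
    using s(1) x(1) by (rule LIMSEQ_subseq_LIMSEQ[rotated])
  then have "(\<lambda>n. fst (x (s n))) \<longlonglongrightarrow> r0" "(\<lambda>n. snd (x (s n))) \<longlonglongrightarrow> b0"
    by (auto dest: tendsto_fst tendsto_snd simp: o_def)
  then have "d0 \<in> variational_solutions r0 b0"
    using s(2) assms(1,2) by (rule closed_variational_solutions) (use d in \<open>auto simp: o_def\<close>)
  moreover have "d0 \<in> - V"
    using s(2) assms(3) d(2) by (intro Lim_in_closed_set[of "- V" "d \<circ> s" sequentially]) auto
  ultimately show False
    using assms(4) by auto
qed

lemma tendsto_unique_variational_solution:
  assumes "(r \<longlongrightarrow> r0) F" "(b \<longlongrightarrow> b0) F" "0 < r0" "0 < b0"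
    and "variational_solutions r0 b0 = {d0}"
    and "\<forall>\<^sub>F t in F. d t \<in> variational_solutions (r t) (b t)"
  shows "(d \<longlongrightarrow> d0) F"
proof (rule topological_tendstoI)
  fix V :: "real set" assume "open V" "d0 \<in> V"
  then have "\<forall>\<^sub>F x in nhds (r0, b0). variational_solutions (fst x) (snd x) \<subseteq> V"
    using assms by (intro upper_hemicontinuous_variational_solutions) auto
  moreover have "filterlim (\<lambda>t. (r t, b t)) (nhds (r0, b0)) F"
    using assms by (intro tendsto_Pair)
  ultimately have "\<forall>\<^sub>F t in F. variational_solutions (r t) (b t) \<subseteq> V"
    by (auto dest: eventually_compose_filterlim)
  then show "\<forall>\<^sub>F t in F. d t \<in> V"
    using assms(6) by eventually_elim auto
qed

section \<open>Lattice path sums\<close>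

text \<open>The partition function of lattice paths with \<open>i\<close> steps left, as a function
  of the current height \<open>k\<close>. The exponent has \<open>k * (k - 1)\<close> instead of the
  square because this is what Gaussian increments give exactly.\<close>

primrec partition_sum :: "real \<Rightarrow> real \<Rightarrow> nat \<Rightarrow> nat \<Rightarrow> real" where
  "partition_sum c \<rho> 0 k = 1"
| "partition_sum c \<rho> (Suc i) k = exp (c * (real k * (real k - 1))) *
     (partition_sum c \<rho> i k + \<rho> * partition_sum c \<rho> i (Suc k))"

lemma partition_sum_pos: "0 < \<rho> \<Longrightarrow> 0 < partition_sum c \<rho> i k"
  by (induction i arbitrary: k) (auto intro!: mult_pos_pos add_pos_pos)

section \<open>Integral comparison and the upper bound on path sums\<close>

lemma integral_partition:
  fixes f :: "real \<Rightarrow> real"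
  assumes "\<And>i. i < n \<Longrightarrow> y i \<le> y (Suc i)" "f integrable_on {y 0..y n}"
  shows "integral {y 0..y n} f = (\<Sum>i<n. integral {y i..y (Suc i)} f)"
  using assms
proof (induction n)
  case (Suc n)
  have "y 0 \<le> y m" if "m \<le> n" for m
    using that
  proof (induction m)
    case (Suc m)
    then show ?case
      using Suc.prems \<open>\<And>i. i < Suc n \<Longrightarrow> y i \<le> y (Suc i)\<close>[of m] by simp
  qed simp
  then have le: "y 0 \<le> y n"
    by simp
  then have "f integrable_on {y 0..y n}"
    using Suc.prems by (intro integrable_on_subinterval[OF Suc.prems(2)]) auto
  then show ?case
    using Suc le Henstock_Kurzweil_Integration.integral_combine[OF le, of "y (Suc n)" f] by auto
qed simp

lemma integral_le_const:
  fixes f :: "real \<Rightarrow> real"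
  assumes "a \<le> b" "f integrable_on {a..b}" "\<And>x. x \<in> {a..b} \<Longrightarrow> f x \<le> C"
  shows "integral {a..b} f \<le> C * (b - a)"
  using integral_le[OF assms(2) integrable_const_ivl, of C] assms by (simp add: mult.commute)

lemma integral_ge_const:
  fixes f :: "real \<Rightarrow> real"
  assumes "a \<le> b" "f integrable_on {a..b}" "\<And>x. x \<in> {a..b} \<Longrightarrow> C \<le> f x"
  shows "C * (b - a) \<le> integral {a..b} f"
  using integral_le[OF integrable_const_ivl assms(2), of C] assms by (simp add: mult.commute)

text \<open>A left Riemann sum overestimates a decreasing function. This replaces the momentum sum
  over lattice heights by the integral in \<open>Lambda_momentum\<close>.\<close>

lemma integral_momentum_le_sum:
  assumes "0 < \<rho>" "0 \<le> \<beta>"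
  shows "real m * integral {0..1} (momentum \<rho> \<beta> d) \<le> (\<Sum>l<m. momentum \<rho> \<beta> d (real l / real m))"
proof (cases "m = 0")
  case False
  define y where "y l = real l / real m" for l
  have y: "y l \<le> y (Suc l)" "0 \<le> y l" "y (Suc l) - y l = 1 / real m" for l
    by (auto simp: y_def divide_right_mono diff_divide_distrib[symmetric])
  have y1: "y (Suc l) \<le> 1" if "l < m" for l
    using that by (auto simp: y_def)
  have ends: "y 0 = 0" "y m = 1"
    using False by (auto simp: y_def)
  have "integral {0..1} (momentum \<rho> \<beta> d) = (\<Sum>l<m. integral {y l..y (Suc l)} (momentum \<rho> \<beta> d))"
    using integral_partition[of m y "momentum \<rho> \<beta> d"] y assms unfolding ends
    by (simp add: momentum_integrable)
  also have "\<dots> \<le> (\<Sum>l<m. momentum \<rho> \<beta> d (y l) * (y (Suc l) - y l))"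
    using assms y y1
    by (intro sum_mono integral_le_const momentum_integrable momentum_antimono) force+
  finally show ?thesis
    using False unfolding y(3) by (simp add: y_def sum_divide_distrib[symmetric] field_simps)
qed simp

text \<open>Each path is grouped by its endpoint \<open>m\<close>; under the tilt by the momentum belonging to that
  endpoint the steps become those of a Markov chain, whose total mass is at most one.\<close>

lemma partition_sum_le_sum:
  assumes "0 < \<rho>" "0 \<le> \<beta>" "0 < n" "i + k \<le> n"
  shows "partition_sum (\<beta> / (real n)\<^sup>2) \<rho> i k \<le>
    (\<Sum>m\<le>n. if k \<le> m then exp (real i * (\<beta> * (real m / real n)\<^sup>2 + ln (1 + \<rho>)) -
       (\<Sum>l=k..<m. momentum \<rho> \<beta> (real m / real n) (real l / real m))) else 0)"
  using assms(4)
proof (induction i arbitrary: k)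
  case 0
  \<comment> \<open>With no steps left the path ends where it starts: the endpoint
    \<open>m = k\<close> alone contributes 1, through an empty momentum sum.\<close>
  have "(1::real) = exp (real 0 * (\<beta> * (real k / real n)\<^sup>2 + ln (1 + \<rho>)) -
       (\<Sum>l=k..<k. momentum \<rho> \<beta> (real k / real n) (real l / real k)))"
    by simp
  also have "\<dots> = (if k \<le> k then exp (real 0 * (\<beta> * (real k / real n)\<^sup>2 + ln (1 + \<rho>)) -
       (\<Sum>l=k..<k. momentum \<rho> \<beta> (real k / real n) (real l / real k))) else 0)"
    by simp
  also have "\<dots> \<le> (\<Sum>m\<le>n. if k \<le> m then exp (real 0 * (\<beta> * (real m / real n)\<^sup>2 + ln (1 + \<rho>)) -
       (\<Sum>l=k..<m. momentum \<rho> \<beta> (real m / real n) (real l / real m))) else 0)"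
    using 0 by (intro member_le_sum) auto
  finally show ?case by simp
next
  case (Suc i)
  define E where "E m = \<beta> * (real m / real n)\<^sup>2 + ln (1 + \<rho>)" for m
  define S where "S m k = (\<Sum>l=k..<m. momentum \<rho> \<beta> (real m / real n) (real l / real m))" for m k
  define U where "U i m k = (if k \<le> m then exp (real i * E m - S m k) else 0)" for i m k
  define w where "w = exp (\<beta> / (real n)\<^sup>2 * (real k * (real k - 1)))"
  have w: "w \<le> exp (\<beta> * (real k / real n)\<^sup>2)"
  proof -
    have "\<beta> / (real n)\<^sup>2 * (real k * (real k - 1)) \<le> \<beta> / (real n)\<^sup>2 * (real k * real k)"
      using assms by (intro mult_left_mono) auto
    then show ?thesis
      by (simp add: w_def power2_eq_square)
  qed
  have step: "w * (U i m k + \<rho> * U i m (Suc k)) \<le> U (Suc i) m k" if "m \<le> n" for m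
  proof -
    consider "m < k" | "m = k" | "k < m" by linarith
    then show ?thesis
    proof cases
      case 1
      then show ?thesis by (simp add: U_def)
    next
      case 2
      \<comment> \<open>At the endpoint height the term with \<open>Suc k\<close> is 0 by the
        default in \<open>U\<close>, and the momentum sum is empty, so only the flat step is
        left.\<close>
      have "w \<le> exp (E m)"
        using w 2 assms unfolding E_def by (simp add: exp_add) (smt (verit) exp_gt_zero mult_le_cancel_left1)
      then have "w * exp (real i * E m) \<le> exp (E m) * exp (real i * E m)"
        by (intro mult_right_mono) auto
      then show ?thesis
        using 2 by (simp add: U_def S_def exp_add[symmetric] algebra_simps)
    next
      case 3
      define p where "p = momentum \<rho> \<beta> (real m / real n) (real k / real m)"
      have S: "S m k = p + S m (Suc k)"
        using 3 by (simp add: S_def p_def sum.atLeast_Suc_lessThan)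
      \<comment> \<open>Under the tilt, the weights of the flat and the upward step add up to
        \<open>exp (E m)\<close>, the factor gained from \<open>i\<close> to
        \<open>Suc i\<close>.\<close>
      have "exp (\<beta> * (real k / real n)\<^sup>2) * (1 + \<rho> * exp p) = exp (E m)"
        using energy_conservation[of \<rho> \<beta> "real k / real m" "real m / real n"] assms 3
        by (simp add: E_def p_def)
      moreover have "w * (1 + \<rho> * exp p) \<le> exp (\<beta> * (real k / real n)\<^sup>2) * (1 + \<rho> * exp p)"
        using w assms by (intro mult_right_mono) (auto intro: add_nonneg_nonneg)
      ultimately have "w * (1 + \<rho> * exp p) * exp (real i * E m - S m k) \<le>
          exp (E m) * exp (real i * E m - S m k)"
        by (intro mult_right_mono) auto
      moreover have "exp p * exp (real i * E m - S m k) = exp (real i * E m - S m (Suc k))"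
        unfolding S exp_add[symmetric] by simp
      moreover have "exp (E m) * exp (real i * E m - S m k) = exp (real (Suc i) * E m - S m k)"
        unfolding exp_add[symmetric] by (simp add: algebra_simps)
      ultimately show ?thesis
        using 3 by (simp add: U_def algebra_simps)
    qed
  qed
  have "partition_sum (\<beta> / (real n)\<^sup>2) \<rho> (Suc i) k =
     w * (partition_sum (\<beta> / (real n)\<^sup>2) \<rho> i k + \<rho> * partition_sum (\<beta> / (real n)\<^sup>2) \<rho> i (Suc k))"
    by (simp add: w_def)
  also have "\<dots> \<le> w * ((\<Sum>m\<le>n. U i m k) + \<rho> * (\<Sum>m\<le>n. U i m (Suc k)))"
    using Suc.IH[of k] Suc.IH[of "Suc k"] Suc.prems assms
    unfolding U_def E_def S_def w_def
    by (intro mult_left_mono add_mono) auto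
  also have "\<dots> = (\<Sum>m\<le>n. w * (U i m k + \<rho> * U i m (Suc k)))"
    by (simp add: sum_distrib_left sum.distrib algebra_simps)
  also have "\<dots> \<le> (\<Sum>m\<le>n. U (Suc i) m k)"
    using step by (intro sum_mono) auto
  finally show ?case
    by (simp only: U_def E_def S_def)
qed

text \<open>There are \<open>n + 1\<close> endpoints. With \<open>d = m / n\<close> each tilted
  weight is at most \<open>exp (n * Lambda \<rho> \<beta> d)\<close>, because the momentum sum
  dominates its integral.\<close>

lemma partition_sum_le:
  assumes "0 < \<rho>" "0 \<le> \<beta>" "0 < n"
    and "\<And>d. d \<in> {0..1} \<Longrightarrow> Lambda \<rho> \<beta> d \<le> L"
  shows "partition_sum (\<beta> / (real n)\<^sup>2) \<rho> n 0 \<le> (real n + 1) * exp (real n * L)"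
proof -
  have "partition_sum (\<beta> / (real n)\<^sup>2) \<rho> n 0 \<le>
    (\<Sum>m\<le>n. exp (real n * (\<beta> * (real m / real n)\<^sup>2 + ln (1 + \<rho>)) -
       (\<Sum>l<m. momentum \<rho> \<beta> (real m / real n) (real l / real m))))"
    using partition_sum_le_sum[OF assms(1-3), of n 0] by (simp add: atLeast0LessThan)
  also have "\<dots> \<le> (\<Sum>m\<le>n. exp (real n * L))"
  proof (rule sum_mono)
    fix m assume "m \<in> {..n}"
    then have "Lambda \<rho> \<beta> (real m / real n) \<le> L"
      using assms by (intro assms(4)) auto
    then have "real n * Lambda \<rho> \<beta> (real m / real n) \<le> real n * L"
      by (intro mult_left_mono) auto
    then have "real n * (\<beta> * (real m / real n)\<^sup>2 + ln (1 + \<rho>)) -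
       real m * integral {0..1} (momentum \<rho> \<beta> (real m / real n)) \<le> real n * L"
      using assms by (simp add: Lambda_momentum[OF assms(1,2)] right_diff_distrib)
    then show "exp (real n * (\<beta> * (real m / real n)\<^sup>2 + ln (1 + \<rho>)) -
       (\<Sum>l<m. momentum \<rho> \<beta> (real m / real n) (real l / real m))) \<le> exp (real n * L)"
      using integral_momentum_le_sum[OF assms(1,2), of m "real m / real n"] by simp
  qed
  finally show ?thesis
    by (simp add: add.commute)
qed

section \<open>Lower bound on path sums\<close>

lemma ln_add_ge_binary_entropy:
  assumes "0 < a" "0 < b" "0 < g" "g < 1"
  shows "binary_entropy g + g * ln b + (1 - g) * ln a \<le> ln (a + b)"
proof -
  have "ln (b / (g * (a + b))) = ln b - ln g - ln (a + b)"
    "ln (a / ((1 - g) * (a + b))) = ln a - ln (1 - g) - ln (a + b)"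
    using assms by (simp_all add: ln_div ln_mult)
  \<comment> \<open>Two-point Gibbs inequality: \<open>ln z \<le> z - 1\<close> for both likelihood
    ratios, averaged with the weights \<open>g\<close> and \<open>1 - g\<close>.\<close>
  moreover have "g * ln (b / (g * (a + b))) \<le> g * (b / (g * (a + b)) - 1)"
    using assms by (intro mult_left_mono ln_le_minus_one) auto
  moreover have "(1 - g) * ln (a / ((1 - g) * (a + b))) \<le> (1 - g) * (a / ((1 - g) * (a + b)) - 1)"
    using assms by (intro mult_left_mono ln_le_minus_one) auto
  moreover have "g * (b / (g * (a + b)) - 1) + (1 - g) * (a / ((1 - g) * (a + b)) - 1) =
      (a + b) / (a + b) - 1"
    unfolding add_divide_distrib using assms by (simp add: right_diff_distrib)
  moreover have "(a + b) / (a + b) = 1"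
    using assms by simp
  ultimately have "g * (ln b - ln g - ln (a + b)) + (1 - g) * (ln a - ln (1 - g) - ln (a + b)) \<le> 0"
    by (metis (no_types, lifting) add_mono diff_self)
  then show ?thesis
    by (simp add: binary_entropy_def algebra_simps)
qed

text \<open>Gibbs' variational principle, tested with independent Bernoulli steps of means \<open>g j\<close>.\<close>

lemma ln_partition_sum_ge:
  assumes "0 < \<rho>" "0 \<le> c" "\<And>j. j < i \<Longrightarrow> 0 < g j \<and> g j < 1"
  shows "(\<Sum>j<i. binary_entropy (g j) + g j * ln \<rho> +
      c * ((real k + sum g {..<j})\<^sup>2 - (real k + sum g {..<j}))) \<le> ln (partition_sum c \<rho> i k)"
  using assms(3)
proof (induction i arbitrary: g k)
  case (Suc i)
  define q where "q = (\<lambda>x::real. c * (x\<^sup>2 - x))"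
  define h where "h j = binary_entropy (g (Suc j)) + g (Suc j) * ln \<rho>" for j
  define s where "s j = sum (g \<circ> Suc) {..<j}" for j
  define Z where "Z = partition_sum c \<rho> i"
  have g0: "0 < g 0" "g 0 < 1"
    using Suc.prems[of 0] by auto
  have Z: "0 < Z k" for k
    using assms by (simp add: Z_def partition_sum_pos)
  have IH: "(\<Sum>j<i. h j + q (real k + s j)) \<le> ln (Z k)" for k
    using Suc.IH[of "g \<circ> Suc" k] Suc.prems by (simp add: h_def q_def s_def Z_def)
  \<comment> \<open>Jensen for the convex \<open>q\<close>; the defect is \<open>c\<close> times the
    Bernoulli variance.\<close>
  have q: "q (x + g 0) \<le> (1 - g 0) * q x + g 0 * q (x + 1)" for x
  proof -
    have "(1 - g 0) * q x + g 0 * q (x + 1) - q (x + g 0) = c * (g 0 * (1 - g 0))"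
      by (simp add: q_def algebra_simps power2_eq_square)
    moreover have "0 \<le> c * (g 0 * (1 - g 0))"
      using assms g0 by auto
    ultimately show ?thesis by linarith
  qed
  \<comment> \<open>The trial path from the mean height \<open>k + g 0\<close> is compared with the
    mixture of those from \<open>k\<close> and \<open>Suc k\<close>, to which the induction
    hypothesis applies.\<close>
  have "(\<Sum>j<i. h j + q (real k + g 0 + s j)) \<le>
      (\<Sum>j<i. (1 - g 0) * (h j + q (real k + s j)) + g 0 * (h j + q (real (Suc k) + s j)))"
  proof (rule sum_mono)
    fix j
    show "h j + q (real k + g 0 + s j) \<le>
        (1 - g 0) * (h j + q (real k + s j)) + g 0 * (h j + q (real (Suc k) + s j))"
      using q[of "real k + s j"] by (simp add: algebra_simps)
  qed
  also have "\<dots> = (1 - g 0) * (\<Sum>j<i. h j + q (real k + s j)) +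
      g 0 * (\<Sum>j<i. h j + q (real (Suc k) + s j))"
    by (simp only: sum.distrib[symmetric] sum_distrib_left)
  also have "\<dots> \<le> (1 - g 0) * ln (Z k) + g 0 * ln (Z (Suc k))"
    using IH[of k] IH[of "Suc k"] g0 by (intro add_mono mult_left_mono) auto
  finally have "binary_entropy (g 0) + g 0 * ln \<rho> + (\<Sum>j<i. h j + q (real k + g 0 + s j)) \<le>
      binary_entropy (g 0) + g 0 * ln (\<rho> * Z (Suc k)) + (1 - g 0) * ln (Z k)"
    using assms Z[of "Suc k"] by (simp add: ln_mult algebra_simps)
  also have "\<dots> \<le> ln (Z k + \<rho> * Z (Suc k))"
    using assms Z g0 by (intro ln_add_ge_binary_entropy) auto
  finally have "q (real k) + (binary_entropy (g 0) + g 0 * ln \<rho> +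
      (\<Sum>j<i. h j + q (real k + g 0 + s j))) \<le> q (real k) + ln (Z k + \<rho> * Z (Suc k))"
    by simp
  also have "\<dots> = ln (partition_sum c \<rho> (Suc i) k)"
  proof -
    have "partition_sum c \<rho> (Suc i) k = exp (q (real k)) * (Z k + \<rho> * Z (Suc k))"
      by (simp add: Z_def q_def power2_eq_square right_diff_distrib)
    moreover have "0 < Z k + \<rho> * Z (Suc k)"
      using Z assms by (intro add_pos_pos mult_pos_pos) auto
    ultimately show ?thesis
      by (simp add: ln_mult)
  qed
  also have "q (real k) + (binary_entropy (g 0) + g 0 * ln \<rho> +
      (\<Sum>j<i. h j + q (real k + g 0 + s j))) =
      (\<Sum>j<Suc i. binary_entropy (g j) + g j * ln \<rho> + q (real k + sum g {..<j}))"
    unfolding sum.lessThan_Suc_shift by (simp add: h_def s_def algebra_simps)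
  finally show ?case
    by (simp add: q_def)
qed simp

text \<open>The extremal path is sampled at the times \<open>j / n\<close>, where its relative
  height is \<open>y j\<close>. At the mean value point \<open>\<xi> j\<close> the drift is exactly
  \<open>n\<close> times the height gained in the step, so partial sums of these drifts reproduce
  the heights without error.\<close>

lemma Riemann_path:
  assumes "0 < \<rho>" "0 \<le> \<beta>" "0 < d" "transit_time \<rho> \<beta> d = 1" "0 < n"
  obtains y \<xi> :: "nat \<Rightarrow> real" where "y 0 = 0" "y n = 1"
    "\<And>j. j \<le> n \<Longrightarrow> y j \<in> {0..1}"
    "\<And>j. j < n \<Longrightarrow> y j < \<xi> j \<and> \<xi> j < y (Suc j)"
    "\<And>j. j < n \<Longrightarrow> drift \<rho> \<beta> d (\<xi> j) = real n * d * (y (Suc j) - y j)"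
    "\<And>j. j < n \<Longrightarrow> d * integral {y j..y (Suc j)} (\<lambda>x. 1 / drift \<rho> \<beta> d x) = 1 / real n"
proof -
  define f where "f x = 1 / drift \<rho> \<beta> d x" for x
  define \<tau> where "\<tau> x = d * integral {0..x} f" for x
  have f_int: "f integrable_on {a..b}" if "0 \<le> a" "b \<le> 1" for a b
    using assms that unfolding f_def by (intro inverse_drift_integrable continuous_intros) auto
  have f_cont: "continuous_on {0..1} f"
    unfolding f_def using assms by (intro continuous_intros) (auto simp: drift_nonzero)
  have f_pos: "0 < f x" if "x \<in> {0..1}" for x
    using drift_pos[OF assms(1,2) that] by (simp add: f_def)
  have der: "(\<tau> has_real_derivative d * f x) (at x within {0..1})" if "x \<in> {0..1}" for x
    unfolding \<tau>_def using integral_has_real_derivative[OF f_cont that]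
    by (auto intro!: derivative_eq_intros)
  have cont: "continuous_on {0..1} \<tau>"
    using der by (rule DERIV_continuous_on)
  have mvt: "\<exists>\<xi>. a < \<xi> \<and> \<xi> < b \<and> \<tau> b - \<tau> a = (b - a) * (d * f \<xi>)"
    if "0 \<le> a" "a < b" "b \<le> 1" for a b
  proof -
    have "(\<tau> has_derivative (*) (d * f x)) (at x within {a..b})" if "a \<le> x" "x \<le> b" for x
    proof -
      have "(\<tau> has_real_derivative d * f x) (at x within {a..b})"
        using that \<open>0 \<le> a\<close> \<open>b \<le> 1\<close> by (intro DERIV_subset[OF der]) auto
      then show ?thesis
        by (simp add: has_field_derivative_def)
    qed
    then have "\<exists>\<xi>\<in>{a<..<b}. \<tau> b - \<tau> a = d * f \<xi> * (b - a)"
      by (rule mvt_simple[OF that(2)])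
    then show ?thesis by (auto simp: mult.commute)
  qed
  have strict: "\<tau> a < \<tau> b" if ab: "0 \<le> a" "a < b" "b \<le> 1" for a b
  proof -
    obtain \<xi> where \<xi>: "a < \<xi>" "\<xi> < b" "\<tau> b - \<tau> a = (b - a) * (d * f \<xi>)"
      using mvt[OF ab] by blast
    moreover have "0 < (b - a) * (d * f \<xi>)"
      using \<xi> ab assms f_pos by (intro mult_pos_pos) auto
    ultimately show ?thesis by linarith
  qed
  have \<tau>0: "\<tau> 0 = 0"
    by (simp add: \<tau>_def)
  have \<tau>1: "\<tau> 1 = 1"
    using assms by (simp add: \<tau>_def f_def[abs_def] transit_time_def)
  \<comment> \<open>\<open>\<tau> x\<close> is the time at which height \<open>d * x\<close> is
    reached; unit transit time gives \<open>\<tau> 1 = 1\<close>, so every \<open>j / n\<close> is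
    attained.\<close>
  have "\<exists>x. 0 \<le> x \<and> x \<le> 1 \<and> \<tau> x = real j / real n" if "j \<le> n" for j
    using that assms(5) \<tau>0 \<tau>1 by (intro IVT' cont) auto
  then obtain y where y: "\<And>j. j \<le> n \<Longrightarrow> y j \<in> {0..1}" "\<And>j. j \<le> n \<Longrightarrow> \<tau> (y j) = real j / real n"
    by (metis atLeastAtMost_iff)
  have less_iff: "a < b" if "\<tau> a < \<tau> b" "a \<in> {0..1}" "b \<in> {0..1}" for a b
    using strict[of b a] that by (cases a b rule: linorder_cases) auto
  have "y 0 = 0"
    using y(1)[of 0] y(2)[of 0] \<tau>0 strict[of 0 "y 0"] by force
  moreover have "y n = 1"
    using y(1)[of n] y(2)[of n] \<tau>1 strict[of "y n" 1] assms by force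
  moreover have y_less: "y j < y (Suc j)" if "j < n" for j
  proof (rule less_iff)
    have "real j / real n < real (Suc j) / real n"
      using assms(5) by (intro divide_strict_right_mono) auto
    then show "\<tau> (y j) < \<tau> (y (Suc j))"
      using y(2)[of j] y(2)[of "Suc j"] that by simp
  qed (use y(1) that in auto)
  have \<tau>_diff: "\<tau> (y (Suc j)) - \<tau> (y j) = 1 / real n" if "j < n" for j
    using that y(2)[of j] y(2)[of "Suc j"] by (simp add: diff_divide_distrib[symmetric])
  have "\<exists>\<xi>. y j < \<xi> \<and> \<xi> < y (Suc j) \<and> 1 / real n = (y (Suc j) - y j) * (d * f \<xi>)" if "j < n" for j
    using mvt[of "y j" "y (Suc j)"] \<tau>_diff[OF that] y_less[OF that] y(1)[of j] y(1)[of "Suc j"] that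
    by auto
  then obtain \<xi> where \<xi>: "\<And>j. j < n \<Longrightarrow> y j < \<xi> j \<and> \<xi> j < y (Suc j)"
    "\<And>j. j < n \<Longrightarrow> 1 / real n = (y (Suc j) - y j) * (d * f (\<xi> j))"
    by metis
  have "drift \<rho> \<beta> d (\<xi> j) = real n * d * (y (Suc j) - y j)" if "j < n" for j
  proof -
    have "\<xi> j \<in> {0..1}"
      using \<xi>(1)[OF that] y(1)[of j] y(1)[of "Suc j"] that by auto
    then show ?thesis
      using \<xi>(2)[OF that] drift_pos[OF assms(1,2), of "\<xi> j" d] assms(5)
      by (simp add: f_def field_simps)
  qed
  moreover have "d * integral {y j..y (Suc j)} (\<lambda>x. 1 / drift \<rho> \<beta> d x) = 1 / real n" if "j < n" for j
  proof -
    have combine: "integral {0..y j} f + integral {y j..y (Suc j)} f = integral {0..y (Suc j)} f"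
      using y_less[OF that] y(1)[of j] y(1)[of "Suc j"] that f_int
      by (intro Henstock_Kurzweil_Integration.integral_combine) auto
    then have "d * integral {y j..y (Suc j)} f = \<tau> (y (Suc j)) - \<tau> (y j)"
      by (simp add: \<tau>_def right_diff_distrib[symmetric] combine[symmetric])
    then show ?thesis
      using \<tau>_diff[OF that] by (simp add: f_def[abs_def])
  qed
  ultimately show thesis
    using that[of y \<xi>] y(1) \<xi>(1) by blast
qed

text \<open>The Bernoulli means are the drifts of the path extremal at \<open>(r0, b0)\<close>,
  while the weights are those of \<open>(\<rho>, \<beta>)\<close>. The discretization errors
  telescope, so the deficit is bounded independently of \<open>n\<close> and disappears from the
  exponent.\<close>

lemma partition_sum_ge:
  assumes "0 < r0" "0 < b0" "d \<in> variational_solutions r0 b0"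
    and "0 < \<rho>" "0 < \<beta>" "0 < n"
  shows "real n * (Lambda r0 b0 d + (ln \<rho> - ln r0) * d + (\<beta> - b0) * second_moment r0 b0 d)
    - (momentum r0 b0 d 0 + 2 * b0 + \<bar>\<beta> - b0\<bar> + \<beta>) \<le> ln (partition_sum (\<beta> / (real n)\<^sup>2) \<rho> n 0)"
proof -
  have d: "0 < d" "d < 1"
    using assms by (auto simp: variational_solutions_def)
  have b0: "0 \<le> b0"
    using assms by simp
  obtain y \<xi> where path: "y 0 = 0" "y n = 1"
    "\<And>j. j \<le> n \<Longrightarrow> y j \<in> {0..1}"
    "\<And>j. j < n \<Longrightarrow> y j < \<xi> j \<and> \<xi> j < y (Suc j)"
    "\<And>j. j < n \<Longrightarrow> drift r0 b0 d (\<xi> j) = real n * d * (y (Suc j) - y j)"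
    "\<And>j. j < n \<Longrightarrow> d * integral {y j..y (Suc j)} (\<lambda>x. 1 / drift r0 b0 d x) = 1 / real n"
    by (rule Riemann_path[OF assms(1) b0 d(1) transit_time_variational_solution[OF assms(1-3)] assms(6)])
      (rule that; assumption)
  define g where "g j = drift r0 b0 d (\<xi> j)" for j
  define P where "P = momentum r0 b0 d"
  define E where "E = b0 * d\<^sup>2 + ln (1 + r0)"
  define S where "S = (\<Sum>j<n. (d * y j)\<^sup>2)"
  have y_le: "y j \<le> y (Suc j)" if "j < n" for j
    using path(4)[OF that] by simp
  have y01: "0 \<le> y j" "y (Suc j) \<le> 1" if "j < n" for j
    using path(3)[of j] path(3)[of "Suc j"] that by auto
  have \<xi>01: "\<xi> j \<in> {0..1}" if "j < n" for j
    using path(4)[OF that] y01[OF that] by auto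
  have g: "0 < g j" "g j < 1" if "j < n" for j
    using drift_pos[OF assms(1) b0 \<xi>01[OF that]] drift_less_1[OF assms(1)] by (auto simp: g_def)
  have g_eq: "g j = real n * d * (y (Suc j) - y j)" if "j < n" for j
    using path(5)[OF that] by (simp add: g_def)
  have sum_g: "sum g {..<j} = real n * (d * y j)" if "j \<le> n" for j
  proof -
    have "sum g {..<j} = (\<Sum>i<j. real n * d * (y (Suc i) - y i))"
      using that by (intro sum.cong) (auto simp: g_eq)
    also have "\<dots> = real n * d * (y j - y 0)"
      by (simp add: sum_distrib_left[symmetric] sum_lessThan_telescope)
    finally show ?thesis
      by (simp add: path(1))
  qed
  \<comment> \<open>Since \<open>g j\<close> is \<open>n * d\<close> times the length of the step,
    the left side is a Riemann sum for \<open>n * d\<close> times the integral of \<open>P\<close>.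
    As \<open>P\<close> decreases and \<open>g j < 1\<close>, each term exceeds its integral by at
    most the drop of \<open>P\<close>, and the drops telescope.\<close>
  have "(\<Sum>j<n. g j * P (\<xi> j)) \<le>
      (\<Sum>j<n. real n * d * integral {y j..y (Suc j)} P + (P (y j) - P (y (Suc j))))"
  proof (rule sum_mono)
    fix j assume "j \<in> {..<n}"
    then have j: "j < n" by simp
    have anti: "P x \<le> P x'" if "y j \<le> x'" "x' \<le> x" "x \<le> y (Suc j)" for x x'
      unfolding P_def using that y01[OF j] assms by (intro momentum_antimono) auto
    have "P (y (Suc j)) * (y (Suc j) - y j) \<le> integral {y j..y (Suc j)} P"
      using y_le[OF j] y01[OF j] anti assms
      by (intro integral_ge_const) (auto simp: P_def intro: momentum_integrable)
    then have "real n * d * (P (y (Suc j)) * (y (Suc j) - y j)) \<le>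
        real n * d * integral {y j..y (Suc j)} P"
      using d by (intro mult_left_mono) auto
    then have "g j * P (y (Suc j)) \<le> real n * d * integral {y j..y (Suc j)} P"
      by (simp add: g_eq[OF j] mult_ac)
    moreover have "g j * (P (\<xi> j) - P (y (Suc j))) \<le> 1 * (P (y j) - P (y (Suc j)))"
      using g[OF j] anti path(4)[OF j] by (intro mult_mono) auto
    ultimately show "g j * P (\<xi> j) \<le>
        real n * d * integral {y j..y (Suc j)} P + (P (y j) - P (y (Suc j)))"
      by (simp add: right_diff_distrib)
  qed
  also have "\<dots> = real n * d * (\<Sum>j<n. integral {y j..y (Suc j)} P) + (P (y 0) - P (y n))"
    using sum_lessThan_telescope'[of "\<lambda>j. P (y j)" n] by (simp add: sum.distrib sum_distrib_left)
  also have "(\<Sum>j<n. integral {y j..y (Suc j)} P) = integral {0..1} P"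
    using integral_partition[of n y P] y_le path(1,2) assms momentum_integrable[of r0 b0 0 1 d]
    by (simp add: P_def)
  finally have sum_P: "(\<Sum>j<n. g j * P (\<xi> j)) \<le> real n * d * integral {0..1} P + P 0"
    using assms by (simp add: path P_def momentum_1)
  \<comment> \<open>Moving from \<open>\<xi> j\<close> to the left node changes a square by at most
    twice the step length, in total by 2.\<close>
  have sum_\<xi>: "(\<Sum>j<n. (d * \<xi> j)\<^sup>2) \<le> S + 2"
  proof -
    have "(\<Sum>j<n. (d * \<xi> j)\<^sup>2) \<le> (\<Sum>j<n. (d * y j)\<^sup>2 + 2 * (y (Suc j) - y j))"
    proof (rule sum_mono)
      fix j assume "j \<in> {..<n}"
      then have j: "j < n" by simp
      have "(\<xi> j)\<^sup>2 - (y j)\<^sup>2 = (\<xi> j + y j) * (\<xi> j - y j)"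
        by (simp add: algebra_simps power2_eq_square)
      also have "\<dots> \<le> 2 * (y (Suc j) - y j)"
        using path(4)[OF j] y01[OF j] by (intro mult_mono) auto
      finally have "d\<^sup>2 * ((\<xi> j)\<^sup>2 - (y j)\<^sup>2) \<le> 1 * (2 * (y (Suc j) - y j))"
        using d path(4)[OF j] y01[OF j]
        by (intro mult_mono) (auto simp: power_le_one intro: power_mono)
      then show "(d * \<xi> j)\<^sup>2 \<le> (d * y j)\<^sup>2 + 2 * (y (Suc j) - y j)"
        by (simp add: algebra_simps power_mult_distrib)
    qed
    also have "\<dots> = S + 2 * (\<Sum>j<n. y (Suc j) - y j)"
      by (simp only: S_def sum.distrib sum_distrib_left)
    also have "\<dots> = S + 2 * (y n - y 0)"
      by (simp only: sum_lessThan_telescope)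
    finally show ?thesis
      by (simp add: path)
  qed
  \<comment> \<open>Each step lasts \<open>1 / n\<close>, so \<open>n * d * I j\<close> is a time
    average of \<open>x\<^sup>2\<close> and lies between the squares at the two nodes. Left and
    right sums differ by \<open>d\<^sup>2\<close>, again by telescoping.\<close>
  have S_bounds: "\<bar>S - real n * second_moment r0 b0 d\<bar> \<le> 1"
  proof -
    define I where "I j = integral {y j..y (Suc j)} (\<lambda>x. x\<^sup>2 / drift r0 b0 d x)" for j
    have I: "(y j)\<^sup>2 \<le> real n * d * I j \<and> real n * d * I j \<le> (y (Suc j))\<^sup>2" if j: "j < n" for j
    proof -
      have 1: "real n * (d * integral {y j..y (Suc j)} (\<lambda>x. 1 / drift r0 b0 d x)) = 1"
        unfolding path(6)[OF j] using assms by simp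
      have int: "(\<lambda>x. f x / drift r0 b0 d x) integrable_on {y j..y (Suc j)}"
        if "continuous_on {y j..y (Suc j)} f" for f
        using that assms y01[OF j] by (intro inverse_drift_integrable) auto
      have pos: "0 < drift r0 b0 d x" if "x \<in> {y j..y (Suc j)}" for x
        using that y01[OF j] by (intro drift_pos[OF assms(1) b0]) auto
      have "integral {y j..y (Suc j)} (\<lambda>x. (y j)\<^sup>2 * (1 / drift r0 b0 d x)) \<le> I j"
        unfolding I_def
      proof (rule integral_le)
        show "(y j)\<^sup>2 * (1 / drift r0 b0 d x) \<le> x\<^sup>2 / drift r0 b0 d x"
          if "x \<in> {y j..y (Suc j)}" for x
          using that pos[OF that] y01[OF j] by (auto intro!: divide_right_mono power_mono)
      qed (intro integrable_on_mult_right int continuous_intros)+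
      then have "real n * d * ((y j)\<^sup>2 * integral {y j..y (Suc j)} (\<lambda>x. 1 / drift r0 b0 d x)) \<le>
          real n * d * I j"
        using d by (intro mult_left_mono) (auto simp del: times_divide_eq_right)
      moreover have "I j \<le> integral {y j..y (Suc j)} (\<lambda>x. (y (Suc j))\<^sup>2 * (1 / drift r0 b0 d x))"
        unfolding I_def
      proof (rule integral_le)
        show "x\<^sup>2 / drift r0 b0 d x \<le> (y (Suc j))\<^sup>2 * (1 / drift r0 b0 d x)"
          if "x \<in> {y j..y (Suc j)}" for x
          using that pos[OF that] y01[OF j] by (auto intro!: divide_right_mono power_mono)
      qed (intro integrable_on_mult_right int continuous_intros)+
      then have "real n * d * I j \<le>
          real n * d * ((y (Suc j))\<^sup>2 * integral {y j..y (Suc j)} (\<lambda>x. 1 / drift r0 b0 d x))"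
        using d by (intro mult_left_mono) (auto simp del: times_divide_eq_right)
      moreover have "real n * d * (c * integral {y j..y (Suc j)} (\<lambda>x. 1 / drift r0 b0 d x)) = c" for c
        using arg_cong[OF 1, of "\<lambda>x. c * x"] by (simp only: mult_ac mult_1)
      ultimately show ?thesis by simp
    qed
    have "(\<Sum>j<n. I j) = integral {0..1} (\<lambda>x. x\<^sup>2 / drift r0 b0 d x)"
    proof -
      have "(\<lambda>x. x\<^sup>2 / drift r0 b0 d x) integrable_on {0..1}"
        using assms by (intro inverse_drift_integrable continuous_intros) auto
      then show ?thesis
        using integral_partition[of n y "\<lambda>x. x\<^sup>2 / drift r0 b0 d x"] y_le
        by (simp add: path(1,2) I_def)
    qed
    moreover have "(\<Sum>j<n. real n * d * I j) = real n * d * (\<Sum>j<n. I j)"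
      by (simp only: sum_distrib_left)
    ultimately have B: "real n * second_moment r0 b0 d = d\<^sup>2 * (\<Sum>j<n. real n * d * I j)"
      by (simp only: second_moment_def power2_eq_square power3_eq_cube mult_ac)
    have "(\<Sum>j<n. (y j)\<^sup>2) \<le> (\<Sum>j<n. real n * d * I j)"
      using I by (intro sum_mono) auto
    then have "S \<le> real n * second_moment r0 b0 d"
      unfolding B S_def power_mult_distrib sum_distrib_left[symmetric] by (intro mult_left_mono) auto
    moreover have "(\<Sum>j<n. real n * d * I j) \<le> (\<Sum>j<n. (y (Suc j))\<^sup>2)"
      using I by (intro sum_mono) auto
    then have "real n * second_moment r0 b0 d \<le> d\<^sup>2 * (\<Sum>j<n. (y (Suc j))\<^sup>2)"
      unfolding B by (intro mult_left_mono) auto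
    moreover have "d\<^sup>2 * (\<Sum>j<n. (y (Suc j))\<^sup>2) = S + d\<^sup>2"
    proof -
      have "(\<Sum>j<n. (y (Suc j))\<^sup>2) = (\<Sum>j<n. (y j)\<^sup>2) + ((y n)\<^sup>2 - (y 0)\<^sup>2)"
        using sum_lessThan_telescope[of "\<lambda>j. (y j)\<^sup>2" n] by (simp add: sum_subtractf)
      then show ?thesis
        by (simp add: S_def power_mult_distrib sum_distrib_left[symmetric] path distrib_left)
    qed
    moreover have "d\<^sup>2 \<le> 1"
      using d by (simp add: power_le_one)
    ultimately show ?thesis by linarith
  qed
  \<comment> \<open>Legendre duality at \<open>(r0, b0)\<close> evaluates the entropy of the trial
    path, the only part that does not change when the parameters become
    \<open>(\<rho>, \<beta>)\<close>.\<close>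
  have "(\<Sum>j<n. binary_entropy (g j) + g j * ln r0 + b0 * (d * \<xi> j)\<^sup>2) = (\<Sum>j<n. E - g j * P (\<xi> j))"
    using binary_entropy_drift[OF assms(1) b0 \<xi>01] by (intro sum.cong) (auto simp: g_def E_def P_def)
  then have "(\<Sum>j<n. binary_entropy (g j) + g j * ln r0) =
      real n * E - (\<Sum>j<n. g j * P (\<xi> j)) - b0 * (\<Sum>j<n. (d * \<xi> j)\<^sup>2)"
    by (simp add: sum.distrib sum_subtractf sum_distrib_left)
  moreover have "b0 * (\<Sum>j<n. (d * \<xi> j)\<^sup>2) \<le> b0 * (S + 2)"
    using sum_\<xi> b0 by (intro mult_left_mono) auto
  moreover have "real n * Lambda r0 b0 d = real n * E - real n * d * integral {0..1} P"
    by (simp add: Lambda_momentum[OF assms(1) b0] E_def P_def right_diff_distrib)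
  ultimately have entropy: "real n * Lambda r0 b0 d - P 0 - b0 * (S + 2) \<le>
      (\<Sum>j<n. binary_entropy (g j) + g j * ln r0)"
    using sum_P by linarith
  have "\<bar>(\<beta> - b0) * (S - real n * second_moment r0 b0 d)\<bar> \<le> \<bar>\<beta> - b0\<bar> * 1"
    unfolding abs_mult using S_bounds by (intro mult_left_mono) auto
  then have "(\<beta> - b0) * (real n * second_moment r0 b0 d) - \<bar>\<beta> - b0\<bar> \<le> (\<beta> - b0) * S"
    by (simp add: right_diff_distrib abs_le_iff)
  with entropy have "real n * (Lambda r0 b0 d + (ln \<rho> - ln r0) * d + (\<beta> - b0) * second_moment r0 b0 d)
    - (momentum r0 b0 d 0 + 2 * b0 + \<bar>\<beta> - b0\<bar> + \<beta>) \<le>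
    (\<Sum>j<n. binary_entropy (g j) + g j * ln r0) + (ln \<rho> - ln r0) * (real n * d) + \<beta> * S - \<beta>"
    by (simp add: P_def algebra_simps)
  also have "\<dots> = (\<Sum>j<n. binary_entropy (g j) + g j * ln r0) + (ln \<rho> - ln r0) * sum g {..<n} + \<beta> * S - \<beta>"
    using sum_g[of n] by (simp add: path)
  also have "\<dots> = (\<Sum>j<n. binary_entropy (g j) + g j * ln \<rho> + \<beta> * (d * y j)\<^sup>2) - \<beta>"
    by (simp add: S_def sum.distrib sum_distrib_left sum_distrib_right algebra_simps)
  \<comment> \<open>The constant \<open>\<beta>\<close> is spread evenly over the steps to pay for
    the linear part of \<open>K * (K - 1)\<close>, which costs at most \<open>\<beta> / n\<close>
    per step as \<open>d * y j \<le> 1\<close>.\<close>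
  also have "\<dots> = (\<Sum>j<n. binary_entropy (g j) + g j * ln \<rho> + \<beta> * (d * y j)\<^sup>2 - \<beta> / real n)"
    using assms by (simp add: sum_subtractf)
  also have "\<dots> \<le> (\<Sum>j<n. binary_entropy (g j) + g j * ln \<rho> +
      \<beta> / (real n)\<^sup>2 * ((real 0 + sum g {..<j})\<^sup>2 - (real 0 + sum g {..<j})))"
  proof (rule sum_mono)
    fix j assume "j \<in> {..<n}"
    then have j: "j < n" by simp
    have "d * y j \<le> 1 * 1"
      using d y01[OF j] y_le[OF j] by (intro mult_mono) auto
    then have "\<beta> * (d * y j) / real n \<le> \<beta> * 1 / real n"
      using assms by (intro divide_right_mono mult_left_mono) auto
    moreover have "\<beta> / (real n)\<^sup>2 * ((real 0 + sum g {..<j})\<^sup>2 - (real 0 + sum g {..<j})) =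
        \<beta> * (d * y j)\<^sup>2 - \<beta> * (d * y j) / real n"
      using sum_g[of j] j assms by (simp add: field_simps power2_eq_square)
    ultimately show "binary_entropy (g j) + g j * ln \<rho> + \<beta> * (d * y j)\<^sup>2 - \<beta> / real n \<le>
      binary_entropy (g j) + g j * ln \<rho> +
      \<beta> / (real n)\<^sup>2 * ((real 0 + sum g {..<j})\<^sup>2 - (real 0 + sum g {..<j}))"
      by simp
  qed
  also have "\<dots> \<le> ln (partition_sum (\<beta> / (real n)\<^sup>2) \<rho> n 0)"
    using assms g by (intro ln_partition_sum_ge) auto
  finally show ?thesis .
qed

section \<open>Moments of the growth process\<close>

text \<open>Completing the square: the tilt shifts the Gaussian mean, so exponential moments are
  read off from the total mass of the shifted density.\<close>

lemma normal_density_exp: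
  assumes "0 < s"
  shows "normal_density 0 s x * exp (a * x) = exp (a\<^sup>2 * s\<^sup>2 / 2) * normal_density (a * s\<^sup>2) s x"
proof -
  have "- x\<^sup>2 / (2 * s\<^sup>2) + a * x = a\<^sup>2 * s\<^sup>2 / 2 + - (x - a * s\<^sup>2)\<^sup>2 / (2 * s\<^sup>2)"
    using assms by (simp add: field_simps power2_eq_square)
  then have "exp (- x\<^sup>2 / (2 * s\<^sup>2)) * exp (a * x) = exp (a\<^sup>2 * s\<^sup>2 / 2) * exp (- (x - a * s\<^sup>2)\<^sup>2 / (2 * s\<^sup>2))"
    by (simp only: exp_add[symmetric])
  then show ?thesis
    by (simp add: normal_density_def)
qed

context standard_brownian_motion
begin

lemma increment_exp_moment:
  assumes "0 \<le> s" "s < t"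
  shows "integrable M (\<lambda>\<omega>. exp (a * (W t \<omega> - W s \<omega>)))"
    and "(\<integral>\<omega>. exp (a * (W t \<omega> - W s \<omega>)) \<partial>M) = exp (a\<^sup>2 * (t - s) / 2)"
proof -
  define v where "v = sqrt (t - s)"
  have v: "0 < v" "v\<^sup>2 = t - s"
    using assms by (auto simp: v_def)
  have dist: "distributed M lborel (\<lambda>\<omega>. W t \<omega> - W s \<omega>) (normal_density 0 v)"
    unfolding v_def using assms by (rule W_gaussian)
  have "integrable lborel (\<lambda>x. normal_density 0 v x * exp (a * x))"
    unfolding normal_density_exp[OF v(1)] using v(1) by (intro integrable_mult_right) auto
  then show "integrable M (\<lambda>\<omega>. exp (a * (W t \<omega> - W s \<omega>)))"
    using distributed_integrable[OF dist, of "\<lambda>x. exp (a * x)"] by simp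
  have "(\<integral>\<omega>. exp (a * (W t \<omega> - W s \<omega>)) \<partial>M) = (\<integral>x. normal_density 0 v x * exp (a * x) \<partial>lborel)"
    using distributed_integral[OF dist, of "\<lambda>x. exp (a * x)"] by simp
  also have "\<dots> = exp (a\<^sup>2 * (t - s) / 2)"
    unfolding normal_density_exp[OF v(1)] using integral_normal_density[OF v(1)] by (simp add: v(2))
  finally show "(\<integral>\<omega>. exp (a * (W t \<omega> - W s \<omega>)) \<partial>M) = exp (a\<^sup>2 * (t - s) / 2)" .
qed

text \<open>Expanding the factor \<open>1 + \<rho> * s\<close> raises the power by one, and the next
  increment is independent of the past. This is the recursion of \<open>partition_sum\<close>, with
  the power \<open>k\<close> in the role of the height.\<close>

lemma growth_process_moment:
  assumes "0 < \<tau>"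
  shows "integrable M (\<lambda>\<omega>. growth_process W x0 \<rho> \<sigma> \<tau> i \<omega> *
      exp (\<sigma> * W (real i * \<tau>) \<omega> - \<sigma>\<^sup>2 * (real i * \<tau>) / 2) ^ k) \<and>
    (\<integral>\<omega>. growth_process W x0 \<rho> \<sigma> \<tau> i \<omega> *
      exp (\<sigma> * W (real i * \<tau>) \<omega> - \<sigma>\<^sup>2 * (real i * \<tau>) / 2) ^ k \<partial>M) =
    x0 * partition_sum (\<sigma>\<^sup>2 * \<tau> / 2) \<rho> i k"
proof (induction i arbitrary: k)
  case 0
  have AE: "AE \<omega> in M. exp (\<sigma> * W 0 \<omega>) ^ k = 1"
    using W_zero by eventually_elim simp
  have meas: "W 0 \<in> borel_measurable M"
    by (rule W_measurable) simp
  have "integrable M (\<lambda>\<omega>. x0 * exp (\<sigma> * W 0 \<omega>) ^ k) \<longleftrightarrow> integrable M (\<lambda>\<omega>. x0)"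
    using AE meas by (intro integrable_cong_AE) auto
  moreover have "(\<integral>\<omega>. x0 * exp (\<sigma> * W 0 \<omega>) ^ k \<partial>M) = (\<integral>\<omega>. x0 \<partial>M)"
    using AE meas by (intro integral_cong_AE) auto
  ultimately show ?case
    by (simp add: prob_space)
next
  case (Suc i)
  define s where "s \<omega> = exp (\<sigma> * W (real i * \<tau>) \<omega> - \<sigma>\<^sup>2 * (real i * \<tau>) / 2)" for \<omega>
  define X where "X = growth_process W x0 \<rho> \<sigma> \<tau> i"
  define Z where "Z j \<omega> = W (real (Suc j) * \<tau>) \<omega> - W (real j * \<tau>) \<omega>" for j \<omega>
  define Y where "Y \<omega> = X \<omega> * s \<omega> ^ k + \<rho> * (X \<omega> * s \<omega> ^ Suc k)" for \<omega>
  define \<xi> where "\<xi> \<omega> = exp (\<sigma> * Z i \<omega> - \<sigma>\<^sup>2 * \<tau> / 2) ^ k" for \<omega>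
  \<comment> \<open>\<open>W'\<close> reads the path off a sequence of increments, the floor turning
    the time \<open>j * \<tau>\<close> back into \<open>j\<close>. Running
    \<open>growth_process\<close> on \<open>W'\<close> exhibits the state after \<open>i\<close>
    steps as a measurable function of the first \<open>i\<close> increments, to which independence
    applies.\<close>
  define W' :: "real \<Rightarrow> (nat \<Rightarrow> real) \<Rightarrow> real" where "W' t f = (\<Sum>l<nat \<lfloor>t / \<tau>\<rfloor>. f l)" for t f
  define h where "h f = growth_process W' x0 \<rho> \<sigma> \<tau> i f *
      exp (\<sigma> * W' (real i * \<tau>) f - \<sigma>\<^sup>2 * (real i * \<tau>) / 2) ^ k +
      \<rho> * (growth_process W' x0 \<rho> \<sigma> \<tau> i f *
      exp (\<sigma> * W' (real i * \<tau>) f - \<sigma>\<^sup>2 * (real i * \<tau>) / 2) ^ Suc k)" for f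
  have W': "W' (real j * \<tau>) f = (\<Sum>l<j. f l)" for j f
    using assms by (simp add: W'_def)
  have meas_W': "W' (real j * \<tau>) \<in> borel_measurable (Pi\<^sub>M {..<i} (\<lambda>_. borel))" if "j \<le> i" for j
    unfolding W' using that by (intro borel_measurable_sum measurable_component_singleton) auto
  have meas_growth: "growth_process W' x0 \<rho> \<sigma> \<tau> j \<in> borel_measurable (Pi\<^sub>M {..<i} (\<lambda>_. borel))"
    if "j \<le> i" for j
    using that
  proof (induction j)
    case 0
    have "growth_process W' x0 \<rho> \<sigma> \<tau> 0 = (\<lambda>f. x0)"
      by (rule ext) simp
    then show ?case by simp
  next
    case (Suc j)
    then have [measurable]: "growth_process W' x0 \<rho> \<sigma> \<tau> j \<in> borel_measurable (Pi\<^sub>M {..<i} (\<lambda>_. borel))"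
      "W' (real j * \<tau>) \<in> borel_measurable (Pi\<^sub>M {..<i} (\<lambda>_. borel))"
      using meas_W' by auto
    have "growth_process W' x0 \<rho> \<sigma> \<tau> (Suc j) =
        (\<lambda>f. (1 + \<rho> * exp (\<sigma> * W' (real j * \<tau>) f - \<sigma>\<^sup>2 * (real j * \<tau>) / 2)) *
          growth_process W' x0 \<rho> \<sigma> \<tau> j f)"
      by (rule ext) simp
    then show ?case by simp
  qed
  have meas_h: "h \<in> borel_measurable (Pi\<^sub>M {..<i} (\<lambda>_. borel))"
    using meas_growth[of i] meas_W'[of i] unfolding h_def by simp
  have indep: "indep_vars (\<lambda>_. borel) Z {..<Suc i}"
    unfolding Z_def using assms by (intro W_indep) auto
  have "indep_var (Pi\<^sub>M {..<i} (\<lambda>_. borel)) (\<lambda>\<omega>. restrict (\<lambda>j. Z j \<omega>) {..<i})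
     (Pi\<^sub>M {i} (\<lambda>_. borel)) (\<lambda>\<omega>. restrict (\<lambda>j. Z j \<omega>) {i})"
    using indep by (rule indep_var_restrict) auto
  then have "indep_var borel (h \<circ> (\<lambda>\<omega>. restrict (\<lambda>j. Z j \<omega>) {..<i}))
     borel ((\<lambda>f. exp (\<sigma> * f i - \<sigma>\<^sup>2 * \<tau> / 2) ^ k) \<circ> (\<lambda>\<omega>. restrict (\<lambda>j. Z j \<omega>) {i}))"
    using meas_h by (rule indep_var_compose) simp
  moreover have "(\<lambda>f. exp (\<sigma> * f i - \<sigma>\<^sup>2 * \<tau> / 2) ^ k) \<circ> (\<lambda>\<omega>. restrict (\<lambda>j. Z j \<omega>) {i}) = \<xi>"
    by (auto simp: \<xi>_def)
  ultimately have indep': "indep_var borel (\<lambda>\<omega>. h (restrict (\<lambda>j. Z j \<omega>) {..<i})) borel \<xi>"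
    by (simp add: o_def)
  have growth_eq: "growth_process W' x0 \<rho> \<sigma> \<tau> j (restrict (\<lambda>j. Z j \<omega>) {..<i}) =
      growth_process W x0 \<rho> \<sigma> \<tau> j \<omega>" "W' (real j * \<tau>) (restrict (\<lambda>j. Z j \<omega>) {..<i}) = W (real j * \<tau>) \<omega>"
    if "j \<le> i" "W 0 \<omega> = 0" for j \<omega>
  proof -
    have eq: "W' (real j * \<tau>) (restrict (\<lambda>j. Z j \<omega>) {..<i}) = W (real j * \<tau>) \<omega>" if "j \<le> i" for j
    proof -
      have "W' (real j * \<tau>) (restrict (\<lambda>j. Z j \<omega>) {..<i}) = (\<Sum>l<j. Z l \<omega>)"
        unfolding W' using that by (intro sum.cong) auto
      also have "\<dots> = W (real j * \<tau>) \<omega> - W (real 0 * \<tau>) \<omega>"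
        unfolding Z_def by (rule sum_lessThan_telescope)
      finally show ?thesis
        using \<open>W 0 \<omega> = 0\<close> by simp
    qed
    then show "W' (real j * \<tau>) (restrict (\<lambda>j. Z j \<omega>) {..<i}) = W (real j * \<tau>) \<omega>"
      using that by simp
    show "growth_process W' x0 \<rho> \<sigma> \<tau> j (restrict (\<lambda>j. Z j \<omega>) {..<i}) =
        growth_process W x0 \<rho> \<sigma> \<tau> j \<omega>"
      using that(1) by (induction j) (simp_all add: eq)
  qed
  \<comment> \<open>The path is recovered from its increments only where
    \<open>W 0 \<omega> = 0\<close>, that is, almost surely.\<close>
  have AE: "AE \<omega> in M. h (restrict (\<lambda>j. Z j \<omega>) {..<i}) = Y \<omega>"
    using W_zero by eventually_elim (simp add: h_def growth_eq Y_def X_def s_def)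
  have IH: "integrable M (\<lambda>\<omega>. X \<omega> * s \<omega> ^ k)"
    "(\<integral>\<omega>. X \<omega> * s \<omega> ^ k \<partial>M) = x0 * partition_sum (\<sigma>\<^sup>2 * \<tau> / 2) \<rho> i k" for k
    using Suc.IH[of k] by (auto simp: X_def s_def)
  have Y_int: "integrable M Y"
    unfolding Y_def using IH(1)[of k] IH(1)[of "Suc k"] by simp
  have Y_eq: "integral\<^sup>L M Y =
      x0 * (partition_sum (\<sigma>\<^sup>2 * \<tau> / 2) \<rho> i k + \<rho> * partition_sum (\<sigma>\<^sup>2 * \<tau> / 2) \<rho> i (Suc k))"
    unfolding Y_def using IH(1)[of k] IH(1)[of "Suc k"] IH(2)[of k] IH(2)[of "Suc k"]
    by (simp add: algebra_simps)
  have \<xi>_eq: "\<xi> = (\<lambda>\<omega>. exp (- (real k * (\<sigma>\<^sup>2 * \<tau> / 2))) *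
      exp (real k * \<sigma> * (W (real (Suc i) * \<tau>) \<omega> - W (real i * \<tau>) \<omega>)))"
    by (auto simp: \<xi>_def Z_def exp_of_nat_mult[symmetric] exp_add[symmetric] algebra_simps)
  have lt: "0 \<le> real i * \<tau>" "real i * \<tau> < real (Suc i) * \<tau>"
    using assms by auto
  have \<xi>_int: "integrable M \<xi>"
    unfolding \<xi>_eq using increment_exp_moment(1)[OF lt] by simp
  have "integral\<^sup>L M \<xi> =
      exp (- (real k * (\<sigma>\<^sup>2 * \<tau> / 2))) * exp ((real k * \<sigma>)\<^sup>2 * (real (Suc i) * \<tau> - real i * \<tau>) / 2)"
    unfolding \<xi>_eq using increment_exp_moment(2)[OF lt, of "real k * \<sigma>"] by simp
  \<comment> \<open>The normalization of the geometric Brownian motion subtracts \<open>k\<close>,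
    turning \<open>k\<^sup>2\<close> into \<open>k * (k - 1)\<close>.\<close>
  also have "\<dots> = exp (\<sigma>\<^sup>2 * \<tau> / 2 * (real k * (real k - 1)))"
    unfolding exp_add[symmetric] by (simp add: field_simps power2_eq_square)
  finally have \<xi>_mean: "integral\<^sup>L M \<xi> = exp (\<sigma>\<^sup>2 * \<tau> / 2 * (real k * (real k - 1)))" .
  have meas: "(\<lambda>\<omega>. h (restrict (\<lambda>j. Z j \<omega>) {..<i})) \<in> borel_measurable M"
    using indep_var_rv1[OF indep'] .
  have int': "integrable M (\<lambda>\<omega>. h (restrict (\<lambda>j. Z j \<omega>) {..<i}))"
    using integrable_cong_AE[OF meas borel_measurable_integrable[OF Y_int] AE] Y_int by blast
  have mean': "(\<integral>\<omega>. h (restrict (\<lambda>j. Z j \<omega>) {..<i}) \<partial>M) = integral\<^sup>L M Y"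
    using Y_int meas AE by (intro integral_cong_AE) auto
  have AE': "AE \<omega> in M. h (restrict (\<lambda>j. Z j \<omega>) {..<i}) * \<xi> \<omega> = Y \<omega> * \<xi> \<omega>"
    using AE by eventually_elim simp
  have meas': "(\<lambda>\<omega>. h (restrict (\<lambda>j. Z j \<omega>) {..<i}) * \<xi> \<omega>) \<in> borel_measurable M"
    "(\<lambda>\<omega>. Y \<omega> * \<xi> \<omega>) \<in> borel_measurable M"
    using meas Y_int \<xi>_int by auto
  have step: "growth_process W x0 \<rho> \<sigma> \<tau> (Suc i) \<omega> *
      exp (\<sigma> * W (real (Suc i) * \<tau>) \<omega> - \<sigma>\<^sup>2 * (real (Suc i) * \<tau>) / 2) ^ k = Y \<omega> * \<xi> \<omega>" for \<omega>
  proof -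
    have "exp (\<sigma> * W (real (Suc i) * \<tau>) \<omega> - \<sigma>\<^sup>2 * (real (Suc i) * \<tau>) / 2) =
        s \<omega> * exp (\<sigma> * Z i \<omega> - \<sigma>\<^sup>2 * \<tau> / 2)"
      unfolding s_def exp_add[symmetric] by (simp add: Z_def algebra_simps add_divide_distrib)
    then have "exp (\<sigma> * W (real (Suc i) * \<tau>) \<omega> - \<sigma>\<^sup>2 * (real (Suc i) * \<tau>) / 2) ^ k = s \<omega> ^ k * \<xi> \<omega>"
      by (simp only: \<xi>_def power_mult_distrib)
    moreover have "growth_process W x0 \<rho> \<sigma> \<tau> (Suc i) \<omega> = (1 + \<rho> * s \<omega>) * X \<omega>"
      by (simp add: s_def X_def)
    ultimately show ?thesis
      by (simp only: Y_def) (simp add: algebra_simps)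
  qed
  have "integrable M (\<lambda>\<omega>. Y \<omega> * \<xi> \<omega>)"
    using indep_var_integrable[OF indep' int' \<xi>_int] integrable_cong_AE[OF meas' AE'] by simp
  moreover have "(\<integral>\<omega>. Y \<omega> * \<xi> \<omega> \<partial>M) = integral\<^sup>L M Y * integral\<^sup>L M \<xi>"
    using indep_var_lebesgue_integral[OF indep' int' \<xi>_int] integral_cong_AE[OF meas' AE'] mean'
    by simp
  ultimately show ?case
    unfolding step Y_eq \<xi>_mean by (simp add: mult_ac)
qed

lemma growth_process_mean:
  assumes "0 < \<tau>"
  shows "(\<integral>\<omega>. growth_process W x0 \<rho> \<sigma> \<tau> n \<omega> \<partial>M) = x0 * partition_sum (\<sigma>\<^sup>2 * \<tau> / 2) \<rho> n 0"
  using growth_process_moment[OF assms, of x0 \<rho> \<sigma> n 0] by simp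

end

section \<open>The exponent as the value of the variational problem\<close>

lemma lyapunov_exponent_limit:
  assumes "standard_brownian_motion M W" "0 < x0" "0 < \<rho>" "0 < \<beta>"
    and "is_lyapunov_exponent M W x0 \<rho> \<beta> L"
  shows "(\<lambda>n. ln (partition_sum (\<beta> / (real n)\<^sup>2) \<rho> n 0) / real n) \<longlonglongrightarrow> L"
proof -
  interpret standard_brownian_motion M W by fact
  \<comment> \<open>One admissible scaling identifies the limit: with unit time step, this choice
    turns \<open>\<sigma>\<^sup>2 * \<tau> / 2\<close> into
    \<open>\<beta> / n\<^sup>2\<close>.\<close>
  define \<sigma> where "\<sigma> n = sqrt (2 * \<beta>) / real n" for n :: nat
  have \<sigma>: "0 < \<sigma> n" "(\<sigma> n)\<^sup>2 * 1 * (real n)\<^sup>2 / 2 = \<beta>" "(\<sigma> n)\<^sup>2 * 1 / 2 = \<beta> / (real n)\<^sup>2" if "0 < n" for n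
    using that assms by (auto simp: \<sigma>_def power_divide)
  have "(\<lambda>n. ln (\<integral>\<omega>. growth_process W x0 \<rho> (\<sigma> n) 1 n \<omega> \<partial>M) / real n) \<longlonglongrightarrow> L"
    using assms(5)[unfolded is_lyapunov_exponent_def, rule_format, of \<sigma> "\<lambda>_. 1"] \<sigma> by simp
  moreover have "(\<lambda>n. ln x0 / real n) \<longlonglongrightarrow> 0"
    by (rule lim_const_over_n)
  ultimately have "(\<lambda>n. ln (\<integral>\<omega>. growth_process W x0 \<rho> (\<sigma> n) 1 n \<omega> \<partial>M) / real n - ln x0 / real n)
      \<longlonglongrightarrow> L - 0"
    by (rule tendsto_diff)
  moreover have "\<forall>\<^sub>F n in sequentially.
      ln (\<integral>\<omega>. growth_process W x0 \<rho> (\<sigma> n) 1 n \<omega> \<partial>M) / real n - ln x0 / real n =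
      ln (partition_sum (\<beta> / (real n)\<^sup>2) \<rho> n 0) / real n"
    using eventually_gt_at_top[of 0]
  proof eventually_elim
    case (elim n)
    then show ?case
      using growth_process_mean[of 1 x0 \<rho> "\<sigma> n" n] \<sigma>(3)[OF elim]
        partition_sum_pos[OF assms(3), of "\<beta> / (real n)\<^sup>2" n 0] assms(2)
      by (simp add: ln_mult add_divide_distrib)
  qed
  ultimately show ?thesis
    by (auto dest: Lim_transform_eventually)
qed

lemma lyapunov_exponent_variational:
  assumes "0 < \<rho>" "0 < \<beta>" "d \<in> variational_solutions \<rho> \<beta>"
    and "(\<lambda>n. ln (partition_sum (\<beta> / (real n)\<^sup>2) \<rho> n 0) / real n) \<longlonglongrightarrow> L"
  shows "L \<le> Lambda \<rho> \<beta> d"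
proof (rule LIMSEQ_le[OF assms(4)])
  have "(\<lambda>n::nat. ln 2 / real n + ln (real n) / real n + Lambda \<rho> \<beta> d) \<longlonglongrightarrow> 0 + 0 + Lambda \<rho> \<beta> d"
    by (intro tendsto_add lim_const_over_n lim_ln_over_n tendsto_const)
  then show "(\<lambda>n. ln 2 / real n + ln (real n) / real n + Lambda \<rho> \<beta> d) \<longlonglongrightarrow> Lambda \<rho> \<beta> d"
    by simp
  show "\<exists>N. \<forall>n\<ge>N. ln (partition_sum (\<beta> / (real n)\<^sup>2) \<rho> n 0) / real n \<le>
      ln 2 / real n + ln (real n) / real n + Lambda \<rho> \<beta> d"
  proof (intro exI allI impI)
    fix n :: nat assume n: "1 \<le> n"
    have "partition_sum (\<beta> / (real n)\<^sup>2) \<rho> n 0 \<le> (real n + 1) * exp (real n * Lambda \<rho> \<beta> d)"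
      using assms n variational_solutions_iff[OF assms(1,2)] by (intro partition_sum_le) auto
    \<comment> \<open>The number of endpoints thus costs only \<open>ln 2 + ln n\<close>, which
      vanishes after division by \<open>n\<close>.\<close>
    also have "\<dots> \<le> (2 * real n) * exp (real n * Lambda \<rho> \<beta> d)"
      using n by (intro mult_right_mono) auto
    finally have "ln (partition_sum (\<beta> / (real n)\<^sup>2) \<rho> n 0) \<le> ln ((2 * real n) * exp (real n * Lambda \<rho> \<beta> d))"
      using partition_sum_pos[OF assms(1)] by (intro ln_mono) auto
    also have "\<dots> = ln 2 + ln (real n) + real n * Lambda \<rho> \<beta> d"
      using n by (simp add: ln_mult)
    finally have "ln (partition_sum (\<beta> / (real n)\<^sup>2) \<rho> n 0) / real n \<le>
        (ln 2 + ln (real n) + real n * Lambda \<rho> \<beta> d) / real n"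
      by (rule divide_right_mono) simp
    then show "ln (partition_sum (\<beta> / (real n)\<^sup>2) \<rho> n 0) / real n \<le>
      ln 2 / real n + ln (real n) / real n + Lambda \<rho> \<beta> d"
      using n by (simp add: add_divide_distrib)
  qed
qed

text \<open>A subgradient inequality in the coordinates \<open>(ln \<rho>, \<beta>)\<close>: the path that is extremal at \<open>(r0, b0)\<close> is
  used as a trial path at \<open>(\<rho>, \<beta>)\<close>.\<close>

lemma lyapunov_exponent_subgradient:
  assumes "0 < r0" "0 < b0" "d \<in> variational_solutions r0 b0" "0 < \<rho>" "0 < \<beta>"
    and "(\<lambda>n. ln (partition_sum (\<beta> / (real n)\<^sup>2) \<rho> n 0) / real n) \<longlonglongrightarrow> L"
  shows "Lambda r0 b0 d + (ln \<rho> - ln r0) * d + (\<beta> - b0) * second_moment r0 b0 d \<le> L"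
proof (rule LIMSEQ_le[OF _ assms(6)])
  define A where "A = Lambda r0 b0 d + (ln \<rho> - ln r0) * d + (\<beta> - b0) * second_moment r0 b0 d"
  define C where "C = momentum r0 b0 d 0 + 2 * b0 + \<bar>\<beta> - b0\<bar> + \<beta>"
  have "(\<lambda>n. A - C / real n) \<longlonglongrightarrow> A - 0"
    by (intro tendsto_diff tendsto_const lim_const_over_n)
  then show "(\<lambda>n. A - C / real n) \<longlonglongrightarrow> Lambda r0 b0 d + (ln \<rho> - ln r0) * d + (\<beta> - b0) * second_moment r0 b0 d"
    by (simp add: A_def)
  show "\<exists>N. \<forall>n\<ge>N. A - C / real n \<le> ln (partition_sum (\<beta> / (real n)\<^sup>2) \<rho> n 0) / real n"
  proof (intro exI allI impI)
    fix n :: nat assume n: "1 \<le> n"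
    have "real n * A - C \<le> ln (partition_sum (\<beta> / (real n)\<^sup>2) \<rho> n 0)"
      unfolding A_def C_def using assms(1-5) n by (intro partition_sum_ge) auto
    then have "(real n * A - C) / real n \<le> ln (partition_sum (\<beta> / (real n)\<^sup>2) \<rho> n 0) / real n"
      by (rule divide_right_mono) simp
    then show "A - C / real n \<le> ln (partition_sum (\<beta> / (real n)\<^sup>2) \<rho> n 0) / real n"
      using n by (simp add: diff_divide_distrib)
  qed
qed

section \<open>The two phases\<close>

text \<open>The analysis of the phases rests on these two properties alone. The second exhibits
  \<open>(d, second_moment)\<close> as a subgradient, hence \<open>lam\<close> as convex in
  \<open>(ln \<rho>, \<beta>)\<close>.\<close>

locale variational_exponent =
  fixes lam :: "real \<Rightarrow> real \<Rightarrow> real"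
  assumes lam_eq: "0 < \<rho> \<Longrightarrow> 0 < \<beta> \<Longrightarrow> d \<in> variational_solutions \<rho> \<beta> \<Longrightarrow> lam \<rho> \<beta> = Lambda \<rho> \<beta> d"
    and lam_subgradient: "0 < r0 \<Longrightarrow> 0 < b0 \<Longrightarrow> d \<in> variational_solutions r0 b0 \<Longrightarrow> 0 < \<rho> \<Longrightarrow> 0 < \<beta> \<Longrightarrow>
      lam r0 b0 + (ln \<rho> - ln r0) * d + (\<beta> - b0) * second_moment r0 b0 d \<le> lam \<rho> \<beta>"
begin

text \<open>The subgradient inequalities at \<open>t0\<close> and at \<open>t\<close> squeeze the difference quotient.\<close>

lemma lam_has_derivative_along:
  fixes r b d :: "real \<Rightarrow> real"
  assumes r: "(r has_real_derivative r') (at t0)" and b: "(b has_real_derivative b') (at t0)"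
    and pos: "0 < r t0" "0 < b t0"
    and sol: "\<forall>\<^sub>F t in at t0. d t \<in> variational_solutions (r t) (b t)"
    and lim: "(d \<longlongrightarrow> d0) (at t0)" and d0: "d0 \<in> variational_solutions (r t0) (b t0)"
  shows "((\<lambda>t. lam (r t) (b t)) has_real_derivative
    r' / r t0 * d0 + b' * second_moment (r t0) (b t0) d0) (at t0)"
proof -
  define A where "A t = (ln (r t) - ln (r t0)) / (t - t0)" for t
  define C where "C t = (b t - b t0) / (t - t0)" for t
  define B where "B t = second_moment (r t) (b t) (d t)" for t
  define B0 where "B0 = second_moment (r t0) (b t0) d0"
  define q where "q t = (lam (r t) (b t) - lam (r t0) (b t0)) / (t - t0)" for t
  have r_lim: "(r \<longlongrightarrow> r t0) (at t0)" and b_lim: "(b \<longlongrightarrow> b t0) (at t0)"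
    using r b by (auto dest: DERIV_isCont simp: isCont_def)
  have B_lim: "(B \<longlongrightarrow> B0) (at t0)"
    unfolding B_def B0_def by (rule tendsto_second_moment[OF r_lim b_lim lim pos])
  have "((\<lambda>t. ln (r t)) has_real_derivative r' / r t0) (at t0)"
    using r pos by (auto intro!: derivative_eq_intros)
  then have A_lim: "(A \<longlongrightarrow> r' / r t0) (at t0)"
    unfolding A_def by (simp add: has_field_derivative_iff)
  have C_lim: "(C \<longlongrightarrow> b') (at t0)"
    using b unfolding C_def by (simp add: has_field_derivative_iff)
  have "((\<lambda>t. \<bar>A t\<bar> * \<bar>d t - d0\<bar> + \<bar>C t\<bar> * \<bar>B t - B0\<bar>) \<longlongrightarrow>
      \<bar>r' / r t0\<bar> * \<bar>d0 - d0\<bar> + \<bar>b'\<bar> * \<bar>B0 - B0\<bar>) (at t0)"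
    by (intro tendsto_intros A_lim C_lim B_lim lim)
  then have err: "((\<lambda>t. \<bar>A t\<bar> * \<bar>d t - d0\<bar> + \<bar>C t\<bar> * \<bar>B t - B0\<bar>) \<longlongrightarrow> 0) (at t0)"
    by simp
  have "\<forall>\<^sub>F t in at t0. 0 < r t" "\<forall>\<^sub>F t in at t0. 0 < b t" "\<forall>\<^sub>F t in at t0. t \<noteq> t0"
    using order_tendstoD(1)[OF r_lim pos(1)] order_tendstoD(1)[OF b_lim pos(2)]
    by (auto simp: eventually_at_filter)
  with sol have "\<forall>\<^sub>F t in at t0. norm (q t - (A t * d0 + C t * B0)) \<le>
      \<bar>A t\<bar> * \<bar>d t - d0\<bar> + \<bar>C t\<bar> * \<bar>B t - B0\<bar>"
  proof eventually_elim
    case (elim t)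
    define h where "h = t - t0"
    have h: "h \<noteq> 0"
      using elim by (simp add: h_def)
    define x where "x = ln (r t) - ln (r t0)"
    define y where "y = b t - b t0"
    define z where "z = lam (r t) (b t) - lam (r t0) (b t0)"
    have "x * d0 + y * B0 \<le> z"
      using lam_subgradient[OF pos d0 elim(2,3)] by (simp add: x_def y_def z_def B0_def)
    moreover have "z \<le> x * d t + y * B t"
      using lam_subgradient[OF elim(2,3,1) pos] by (simp add: x_def y_def z_def B_def algebra_simps)
    ultimately have "\<bar>z - (x * d0 + y * B0)\<bar> \<le> \<bar>x * (d t - d0) + y * (B t - B0)\<bar>"
      by (simp add: algebra_simps)
    also have "\<dots> \<le> \<bar>x\<bar> * \<bar>d t - d0\<bar> + \<bar>y\<bar> * \<bar>B t - B0\<bar>"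
      using abs_triangle_ineq[of "x * (d t - d0)" "y * (B t - B0)"] by (simp add: abs_mult)
    finally have "\<bar>z - (x * d0 + y * B0)\<bar> / \<bar>h\<bar> \<le> (\<bar>x\<bar> * \<bar>d t - d0\<bar> + \<bar>y\<bar> * \<bar>B t - B0\<bar>) / \<bar>h\<bar>"
      by (rule divide_right_mono) simp
    moreover have "z / h - (x / h * d0 + y / h * B0) = (z - (x * d0 + y * B0)) / h"
      by (simp add: diff_divide_distrib add_divide_distrib)
    ultimately have "norm (z / h - (x / h * d0 + y / h * B0)) \<le> \<bar>x / h\<bar> * \<bar>d t - d0\<bar> + \<bar>y / h\<bar> * \<bar>B t - B0\<bar>"
      unfolding real_norm_def by (simp only: abs_divide add_divide_distrib) simp
    then show ?case
      unfolding q_def A_def C_def x_def y_def z_def h_def .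
  qed
  then have "((\<lambda>t. q t - (A t * d0 + C t * B0)) \<longlongrightarrow> 0) (at t0)"
    using err by (rule Lim_null_comparison)
  moreover have "((\<lambda>t. A t * d0 + C t * B0) \<longlongrightarrow> r' / r t0 * d0 + b' * B0) (at t0)"
    by (intro tendsto_intros A_lim C_lim)
  ultimately have "((\<lambda>t. q t - (A t * d0 + C t * B0) + (A t * d0 + C t * B0)) \<longlongrightarrow>
      0 + (r' / r t0 * d0 + b' * B0)) (at t0)"
    by (rule tendsto_add)
  then show ?thesis
    by (simp add: has_field_derivative_iff q_def B0_def)
qed

text \<open>Any selection of nearby maximizers converges to the single \<open>d0\<close>, so an
  arbitrary choice can be fed into \<open>lam_has_derivative_along\<close> on horizontal and
  vertical lines.\<close>

lemma lam_has_derivative_unique: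
  assumes "0 < \<rho>" "0 < \<beta>" "variational_solutions \<rho> \<beta> = {d0}"
  shows "((\<lambda>x. lam x \<beta>) has_real_derivative d0 / \<rho>) (at \<rho>)"
    and "((\<lambda>x. lam \<rho> x) has_real_derivative second_moment \<rho> \<beta> d0) (at \<beta>)"
proof -
  define d where "d r b = (SOME d. d \<in> variational_solutions r b)" for r b
  have d: "d r b \<in> variational_solutions r b" if "0 < r" "0 < b" for r b
    unfolding d_def using variational_solutions_nonempty[OF that] by (auto intro: someI)
  have "\<forall>\<^sub>F x in at \<rho>. 0 < x"
    using assms(1) by (intro order_tendstoD) auto
  then have ev: "\<forall>\<^sub>F x in at \<rho>. d x \<beta> \<in> variational_solutions x \<beta>"
    by eventually_elim (use d assms in auto)
  have "((\<lambda>x. lam x \<beta>) has_real_derivative 1 / \<rho> * d0 + 0 * second_moment \<rho> \<beta> d0) (at \<rho>)"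
    using assms ev tendsto_unique_variational_solution[OF _ _ assms ev]
    by (intro lam_has_derivative_along[where r = "\<lambda>x. x" and b = "\<lambda>_. \<beta>"]) auto
  then show "((\<lambda>x. lam x \<beta>) has_real_derivative d0 / \<rho>) (at \<rho>)"
    by simp
  have "\<forall>\<^sub>F x in at \<beta>. 0 < x"
    using assms(2) by (intro order_tendstoD) auto
  then have ev: "\<forall>\<^sub>F x in at \<beta>. d \<rho> x \<in> variational_solutions \<rho> x"
    by eventually_elim (use d assms in auto)
  have "((\<lambda>x. lam \<rho> x) has_real_derivative 0 / \<rho> * d0 + 1 * second_moment \<rho> \<beta> d0) (at \<beta>)"
    using assms ev tendsto_unique_variational_solution[OF _ _ assms ev]
    by (intro lam_has_derivative_along[where r = "\<lambda>_. \<rho>" and b = "\<lambda>x. x"]) auto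
  then show "((\<lambda>x. lam \<rho> x) has_real_derivative second_moment \<rho> \<beta> d0) (at \<beta>)"
    by simp
qed

text \<open>Subgradients are monotone: the two inequalities with base points exchanged are added,
  and the logarithmic terms vanish since \<open>\<rho>\<close> is shared.\<close>

lemma second_moment_monotone:
  assumes "0 < \<rho>" "0 < b" "0 < b'" "d \<in> variational_solutions \<rho> b" "d' \<in> variational_solutions \<rho> b'"
  shows "0 \<le> (b' - b) * (second_moment \<rho> b' d' - second_moment \<rho> b d)"
  using lam_subgradient[OF assms(1,2,4,1,3)] lam_subgradient[OF assms(1,3,5,1,2)]
  by (simp add: algebra_simps)

end

section \<open>The transition curve and its two sides\<close>

locale phase_curve = variational_exponent lam for lam +
  fixes \<beta>cr d1 d2 :: "real \<Rightarrow> real" and \<rho>\<^sub>c :: real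
  assumes curve: "phase_transition_curve = (\<lambda>\<rho>. (\<rho>, \<beta>cr \<rho>)) ` {0<..<\<rho>\<^sub>c}"
    and curve_differentiable: "\<rho> \<in> {0<..<\<rho>\<^sub>c} \<Longrightarrow> \<beta>cr differentiable (at \<rho>)"
    and d_less: "\<rho> \<in> {0<..<\<rho>\<^sub>c} \<Longrightarrow> d1 \<rho> < d2 \<rho>"
    and solutions: "\<rho> \<in> {0<..<\<rho>\<^sub>c} \<Longrightarrow> variational_solutions \<rho> (\<beta>cr \<rho>) = {d1 \<rho>, d2 \<rho>}"
begin

lemma curve_pos:
  assumes "\<rho> \<in> {0<..<\<rho>\<^sub>c}"
  shows "0 < \<rho>" "0 < \<beta>cr \<rho>"
proof -
  have "(\<rho>, \<beta>cr \<rho>) \<in> phase_transition_curve"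
    unfolding curve using assms by auto
  then show "0 < \<rho>" "0 < \<beta>cr \<rho>"
    by (auto simp: phase_transition_curve_def)
qed

text \<open>Two maximizers would put \<open>(r, b)\<close> on the curve. The last premise is vacuous
  for \<open>r \<ge> \<rho>\<^sub>c\<close>, so the limit point of the curve is covered.\<close>

lemma unique_off_curve:
  assumes "0 < r" "0 < b" "r < \<rho>\<^sub>c \<Longrightarrow> b \<noteq> \<beta>cr r"
  shows "variational_solutions r b = {optimal_d r b}"
proof -
  obtain d where d: "d \<in> variational_solutions r b"
    using variational_solutions_nonempty[OF assms(1,2)] by auto
  have "(r, b) \<notin> phase_transition_curve"
    unfolding curve using assms by auto
  then have "e = d" if "e \<in> variational_solutions r b" for e
    using that d assms(1,2) by (cases e d rule: linorder_cases) (auto simp: phase_transition_curve_def)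
  with d have eq: "variational_solutions r b = {d}"
    by blast
  have "optimal_d r b = d"
    unfolding optimal_d_def eq by simp
  then show ?thesis
    using eq by simp
qed

lemma curve_continuous: "\<rho> \<in> {0<..<\<rho>\<^sub>c} \<Longrightarrow> (\<beta>cr \<longlongrightarrow> \<beta>cr \<rho>) (nhds \<rho>)"
  using differentiable_imp_continuous_within[OF curve_differentiable, of \<rho>]
  unfolding isCont_def tendsto_at_iff_tendsto_nhds .

text \<open>Both solutions give the same value of \<open>Lambda\<close>; in the form
  \<open>Lambda_second_moment\<close> the logarithm drops out and \<open>\<beta>cr \<rho>\<close>
  can be divided out.\<close>

lemma second_moment_jump:
  assumes "\<rho> \<in> {0<..<\<rho>\<^sub>c}"
  shows "second_moment \<rho> (\<beta>cr \<rho>) (d2 \<rho>) - second_moment \<rho> (\<beta>cr \<rho>) (d1 \<rho>) = ((d2 \<rho>)\<^sup>2 - (d1 \<rho>)\<^sup>2) / 2"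
proof -
  have "Lambda \<rho> (\<beta>cr \<rho>) (d1 \<rho>) = Lambda \<rho> (\<beta>cr \<rho>) (d2 \<rho>)"
    using lam_eq[OF curve_pos[OF assms]] solutions[OF assms] by (metis insertI1 insertI2)
  then have "\<beta>cr \<rho> * (2 * (second_moment \<rho> (\<beta>cr \<rho>) (d2 \<rho>) - second_moment \<rho> (\<beta>cr \<rho>) (d1 \<rho>)) -
      ((d2 \<rho>)\<^sup>2 - (d1 \<rho>)\<^sup>2)) = 0"
    using curve_pos[OF assms] by (simp add: Lambda_second_moment algebra_simps)
  then show ?thesis
    using curve_pos[OF assms] by auto
qed

lemma d_pos: "\<rho> \<in> {0<..<\<rho>\<^sub>c} \<Longrightarrow> 0 < d1 \<rho> \<and> 0 < d2 \<rho>"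
  using solutions[of \<rho>] by (auto simp: variational_solutions_def)

lemma second_moment_jump_pos:
  assumes "\<rho> \<in> {0<..<\<rho>\<^sub>c}"
  shows "second_moment \<rho> (\<beta>cr \<rho>) (d1 \<rho>) < second_moment \<rho> (\<beta>cr \<rho>) (d2 \<rho>)"
proof -
  have "(d1 \<rho>)\<^sup>2 < (d2 \<rho>)\<^sup>2"
    using d_less[OF assms] d_pos[OF assms] by (intro power_strict_mono) auto
  then have "0 < second_moment \<rho> (\<beta>cr \<rho>) (d2 \<rho>) - second_moment \<rho> (\<beta>cr \<rho>) (d1 \<rho>)"
    unfolding second_moment_jump[OF assms] by simp
  then show ?thesis by simp
qed

text \<open>\<open>s = 1\<close> is the side above the curve and \<open>s = -1\<close> the side below.\<close>

definition side :: "real \<Rightarrow> (real \<times> real) set" where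
  "side s = {(r, b). 0 < r \<and> r < \<rho>\<^sub>c \<and> 0 < b \<and> 0 < s * (b - \<beta>cr r)}"

text \<open>The larger solution carries the larger \<open>second_moment\<close>, the slope of the
  exponent in \<open>\<beta>\<close>, and therefore belongs above the curve.\<close>

definition phase_d :: "real \<Rightarrow> real \<Rightarrow> real" where
  "phase_d s \<rho> = (if 0 < s then d2 \<rho> else d1 \<rho>)"

lemma side_in_curve_sides:
  assumes "s = 1 \<or> s = -1"
  shows "side s \<in> curve_sides \<beta>cr \<rho>\<^sub>c"
proof -
  have "side 1 = {(r, b). 0 < r \<and> r < \<rho>\<^sub>c \<and> \<beta>cr r < b}"
    using curve_pos(2) by (fastforce simp: side_def)
  moreover have "side (-1) = {(r, b). 0 < r \<and> r < \<rho>\<^sub>c \<and> 0 < b \<and> b < \<beta>cr r}"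
    by (auto simp: side_def)
  ultimately show ?thesis
    using assms unfolding curve_sides_def by auto
qed

lemma unique_on_side: "(r, b) \<in> side s \<Longrightarrow> variational_solutions r b = {optimal_d r b}"
  by (intro unique_off_curve) (auto simp: side_def)

lemma continuous_on_optimal_d:
  assumes "\<And>b. b \<in> T \<Longrightarrow> (r, b) \<in> side s"
  shows "continuous_on T (optimal_d r)"
  unfolding continuous_on_def
proof
  fix b assume b: "b \<in> T"
  have pos: "0 < r" "0 < b"
    using assms[OF b] by (auto simp: side_def)
  have "\<forall>\<^sub>F x in at b within T. optimal_d r x \<in> variational_solutions r x"
    unfolding eventually_at_topological using unique_on_side[OF assms] by blast
  then show "(optimal_d r \<longlongrightarrow> optimal_d r b) (at b within T)"
    by (rule tendsto_unique_variational_solution[OF tendsto_const tendsto_ident_at pos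
      unique_on_side[OF assms[OF b]]])
qed

text \<open>Near a point of the curve the maximizer stays close to the two solutions there. At a point
  straight above or below, monotonicity of \<open>second_moment\<close> in \<open>\<beta>\<close> selects the right one, and
  connectedness of vertical segments transports this choice to the whole side.\<close>

lemma tendsto_phase_d:
  assumes \<rho>: "\<rho> \<in> {0<..<\<rho>\<^sub>c}" and s: "s = 1 \<or> s = -1"
  shows "((\<lambda>(r, b). optimal_d r b) \<longlongrightarrow> phase_d s \<rho>) (at (\<rho>, \<beta>cr \<rho>) within side s)"
proof (rule topological_tendstoI)
  fix V :: "real set" assume V: "open V" "phase_d s \<rho> \<in> V"
  define b0 where "b0 = \<beta>cr \<rho>"
  define dt where "dt = phase_d s \<rho>"
  define du where "du = phase_d (-s) \<rho>"
  have pos: "0 < \<rho>" "\<rho> < \<rho>\<^sub>c" "0 < b0"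
    using curve_pos[OF \<rho>] \<rho> by (auto simp: b0_def)
  have sol: "variational_solutions \<rho> b0 = {dt, du}"
    using solutions[OF \<rho>] s by (auto simp: b0_def dt_def du_def phase_d_def)
  have ne: "dt \<noteq> du"
    using d_less[OF \<rho>] s by (auto simp: dt_def du_def phase_d_def)
  have jump: "0 < s * (second_moment \<rho> b0 dt - second_moment \<rho> b0 du)"
    using second_moment_jump_pos[OF \<rho>] s by (auto simp: b0_def dt_def du_def phase_d_def)
  \<comment> \<open>Near the wrong solution \<open>du\<close>, \<open>second_moment\<close> stays on
    the wrong side of its value at \<open>dt\<close>.\<close>
  have "((\<lambda>x. s * (second_moment \<rho> b0 dt - second_moment \<rho> (fst x) (snd x))) \<longlongrightarrow>
      s * (second_moment \<rho> b0 dt - second_moment \<rho> b0 du)) (nhds b0 \<times>\<^sub>F nhds du)"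
    using pos by (intro tendsto_intros tendsto_second_moment filterlim_fst filterlim_snd) auto
  then have "\<forall>\<^sub>F x in nhds b0 \<times>\<^sub>F nhds du. 0 < s * (second_moment \<rho> b0 dt - second_moment \<rho> (fst x) (snd x))"
    using jump by (rule order_tendstoD)
  then obtain P Q where PQ: "eventually P (nhds b0)" "eventually Q (nhds du)"
    "\<And>b d. P b \<Longrightarrow> Q d \<Longrightarrow> 0 < s * (second_moment \<rho> b0 dt - second_moment \<rho> b d)"
    unfolding eventually_prod_filter by auto
  obtain Q' where Q': "open Q'" "du \<in> Q'" "\<And>d. d \<in> Q' \<Longrightarrow> Q d"
    using PQ(2) unfolding eventually_nhds by auto
  obtain Vt Vu where sep: "open Vt" "open Vu" "dt \<in> Vt" "du \<in> Vu" "Vt \<inter> Vu = {}"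
    using hausdorff[OF ne] by auto
  define T where "T = Vt \<inter> V"
  define U where "U = Vu \<inter> Q'"
  have TU: "open T" "open U" "dt \<in> T" "du \<in> U" "T \<inter> U = {}" "T \<subseteq> V" "\<And>d. d \<in> U \<Longrightarrow> Q d"
    using sep V Q' by (auto simp: T_def U_def dt_def)
  have "\<forall>\<^sub>F x in nhds (\<rho>, b0). variational_solutions (fst x) (snd x) \<subseteq> T \<union> U"
    using pos TU sol by (intro upper_hemicontinuous_variational_solutions) auto
  then obtain P1 P2 where P12: "eventually P1 (nhds \<rho>)" "eventually P2 (nhds b0)"
    "\<And>r b. P1 r \<Longrightarrow> P2 b \<Longrightarrow> variational_solutions r b \<subseteq> T \<union> U"
    unfolding nhds_prod eventually_prod_filter by auto
  have "\<forall>\<^sub>F b in nhds b0. P b \<and> P2 b \<and> 0 < b"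
    using PQ(1) P12(2) pos by (intro eventually_conj eventually_nhds_in_open[of "{0<..}", simplified]) auto
  then obtain \<delta> where \<delta>: "0 < \<delta>" "\<And>b. \<bar>b - b0\<bar> < \<delta> \<Longrightarrow> P b \<and> P2 b \<and> 0 < b"
    unfolding eventually_nhds_metric dist_real_def by auto
  define b1 where "b1 = b0 + s * (\<delta> / 2)"
  have b1: "\<bar>b1 - b0\<bar> < \<delta>" "b1 \<noteq> b0" "0 < s * (b1 - b0)"
    using \<delta>(1) s by (auto simp: b1_def)
  have b1_pos: "0 < b1"
    using \<delta>(2)[OF b1(1)] by simp
  define e where "e = optimal_d \<rho> b1"
  have e: "variational_solutions \<rho> b1 = {e}"
    unfolding e_def using b1 b1_pos pos by (intro unique_off_curve) (auto simp: b0_def)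
  have "e \<in> T \<union> U"
    using P12(3)[of \<rho> b1] \<delta>(2)[OF b1(1)] e eventually_nhds_x_imp_x[OF P12(1)] by auto
  moreover have "e \<notin> U"
  proof
    assume "e \<in> U"
    then have "0 < s * (second_moment \<rho> b0 dt - second_moment \<rho> b1 e)"
      using PQ(3)[of b1 e] \<delta>(2)[OF b1(1)] TU by auto
    \<comment> \<open>As \<open>s\<close> squares to 1, this contradicts monotonicity between
      \<open>(\<rho>, b0)\<close> and \<open>(\<rho>, b1)\<close>.\<close>
    then have "0 < (s * (b1 - b0)) * (s * (second_moment \<rho> b0 dt - second_moment \<rho> b1 e))"
      using b1(3) by (rule mult_pos_pos[rotated])
    moreover have "0 \<le> (b1 - b0) * (second_moment \<rho> b1 e - second_moment \<rho> b0 dt)"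
      using pos b1_pos sol e by (intro second_moment_monotone) auto
    ultimately show False
      using s by (auto simp: algebra_simps)
  qed
  ultimately have "e \<in> T" by blast
  \<comment> \<open>The choice made at \<open>(\<rho>, b1)\<close> spreads to all
    \<open>(r, b1)\<close> with \<open>r\<close> near \<open>\<rho>\<close>, which supplies a
    starting point on every vertical segment.\<close>
  then have "\<forall>\<^sub>F x in nhds (\<rho>, b1). variational_solutions (fst x) (snd x) \<subseteq> T"
    using pos TU e b1_pos \<open>e \<in> T\<close> by (intro upper_hemicontinuous_variational_solutions) auto
  moreover have "filterlim (\<lambda>r. (r, b1)) (nhds (\<rho>, b1)) (nhds \<rho>)"
    by (intro tendsto_Pair tendsto_const filterlim_ident)
  ultimately have near1: "\<forall>\<^sub>F r in nhds \<rho>. variational_solutions r b1 \<subseteq> T"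
    by (auto dest: eventually_compose_filterlim)
  have "((\<lambda>r. s * (b1 - \<beta>cr r)) \<longlongrightarrow> s * (b1 - \<beta>cr \<rho>)) (nhds \<rho>)"
    by (intro tendsto_intros curve_continuous \<rho>)
  then have near2: "\<forall>\<^sub>F r in nhds \<rho>. 0 < s * (b1 - \<beta>cr r)"
    using b1(3) by (intro order_tendstoD) (auto simp: b0_def)
  have near3: "\<forall>\<^sub>F b in nhds b0. \<bar>b - b0\<bar> < \<delta>"
    unfolding eventually_nhds_metric dist_real_def using \<delta>(1) by auto
  have "\<forall>\<^sub>F x in nhds (\<rho>, b0). (variational_solutions (fst x) b1 \<subseteq> T \<and> 0 < s * (b1 - \<beta>cr (fst x)) \<and> P1 (fst x))
      \<and> \<bar>snd x - b0\<bar> < \<delta>"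
    unfolding nhds_prod eventually_prod_filter
    using eventually_conj[OF near1 eventually_conj[OF near2 P12(1)]] near3 by fastforce
  then show "\<forall>\<^sub>F x in at (\<rho>, \<beta>cr \<rho>) within side s. (case x of (r, b) \<Rightarrow> optimal_d r b) \<in> V"
    unfolding eventually_at_filter b0_def[symmetric]
  proof eventually_elim
    case (elim x)
    show ?case
    proof (intro impI)
      assume "x \<in> side s"
      then obtain r b where x: "x = (r, b)" "(r, b) \<in> side s"
        by (cases x) auto
      have seg: "\<bar>b' - b0\<bar> < \<delta>" "(r, b') \<in> side s" if b': "b' \<in> closed_segment b1 b" for b'
      proof -
        obtain u where u: "0 \<le> u" "u \<le> 1" "b' = (1 - u) * b1 + u * b"
          using b' by (auto simp: closed_segment_def)
        have "b1 \<in> ball b0 \<delta>" "b \<in> ball b0 \<delta>"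
          using b1(1) elim x by (auto simp: dist_real_def abs_minus_commute)
        then have "closed_segment b1 b \<subseteq> ball b0 \<delta>"
          by (intro closed_segment_subset) auto
        then show lt: "\<bar>b' - b0\<bar> < \<delta>"
          using b' by (auto simp: dist_real_def abs_minus_commute)
        \<comment> \<open>The signed distance to the curve is affine in \<open>b'\<close> and
          positive at both ends of the segment.\<close>
        have "s * (b' - \<beta>cr r) = (1 - u) * (s * (b1 - \<beta>cr r)) + u * (s * (b - \<beta>cr r))"
          by (simp add: u algebra_simps)
        also have "\<dots> > 0"
        proof (cases "u = 0")
          case True
          then show ?thesis using elim x by simp
        next
          case False
          have "0 < s * (b - \<beta>cr r)"
            using x by (simp add: side_def)
          then have "0 < u * (s * (b - \<beta>cr r))"
            using False u by (intro mult_pos_pos[of u]) auto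
          moreover have "0 \<le> (1 - u) * (s * (b1 - \<beta>cr r))"
            using u elim x by (intro mult_nonneg_nonneg[of "1 - u"]) (auto intro: less_imp_le)
          ultimately show ?thesis by linarith
        qed
        finally show "(r, b') \<in> side s"
          using x \<delta>(2)[OF lt] by (auto simp: side_def)
      qed
      let ?I = "optimal_d r ` closed_segment b1 b"
      have mem: "optimal_d r b' \<in> variational_solutions r b'" if "b' \<in> closed_segment b1 b" for b'
        using unique_on_side[OF seg(2)[OF that]] by simp
      have "connected ?I"
        using seg by (intro connected_continuous_image continuous_on_optimal_d) auto
      moreover have sub: "?I \<subseteq> T \<union> U"
      proof
        fix d assume "d \<in> ?I"
        then obtain b' where b': "b' \<in> closed_segment b1 b" "d = optimal_d r b'"
          by blast
        have "P1 r"
          using elim x by simp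
        then have "variational_solutions r b' \<subseteq> T \<union> U"
          using \<delta>(2)[OF seg(1)[OF b'(1)]] by (intro P12(3)) auto
        then show "d \<in> T \<union> U"
          using mem[OF b'(1)] b'(2) by blast
      qed
      moreover have "optimal_d r b1 \<in> T \<inter> ?I"
        using mem[of b1] elim x by auto
      ultimately have "U \<inter> ?I = {}"
        using connectedD[of ?I T U] TU by blast
      moreover have "optimal_d r b \<in> ?I"
        by simp
      ultimately have "optimal_d r b \<in> T"
        using sub by blast
      then show "(case x of (r, b) \<Rightarrow> optimal_d r b) \<in> V"
        using TU x by auto
    qed
  qed
qed

text \<open>A solution on the curve is a vertical limit of \<open>optimal_d\<close> from its side,
  and near \<open>(\<rho>, \<beta>cr \<rho>)\<close> all values of \<open>optimal_d\<close> on that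
  side are already close to \<open>phase_d s \<rho>\<close>.\<close>

lemma phase_d_continuous:
  assumes \<rho>: "\<rho> \<in> {0<..<\<rho>\<^sub>c}" and s: "s = 1 \<or> s = -1"
  shows "(phase_d s \<longlongrightarrow> phase_d s \<rho>) (at \<rho>)"
proof (rule tendstoI)
  fix \<epsilon> :: real assume \<epsilon>: "0 < \<epsilon>"
  have "\<forall>\<^sub>F x in at (\<rho>, \<beta>cr \<rho>) within side s. dist (case x of (r, b) \<Rightarrow> optimal_d r b) (phase_d s \<rho>) < \<epsilon> / 2"
    using tendsto_phase_d[OF assms] \<epsilon> by (intro tendstoD) auto
  then have "\<forall>\<^sub>F x in nhds (\<rho>, \<beta>cr \<rho>). x \<in> side s \<longrightarrow>
      dist (case x of (r, b) \<Rightarrow> optimal_d r b) (phase_d s \<rho>) < \<epsilon> / 2"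
    unfolding eventually_at_filter
    by eventually_elim (auto simp: side_def)
  then obtain P Q where PQ: "eventually P (nhds \<rho>)" "eventually Q (nhds (\<beta>cr \<rho>))"
    "\<And>r b. P r \<Longrightarrow> Q b \<Longrightarrow> (r, b) \<in> side s \<Longrightarrow> dist (optimal_d r b) (phase_d s \<rho>) < \<epsilon> / 2"
    unfolding nhds_prod eventually_prod_filter by auto
  obtain Q' where Q': "open Q'" "\<beta>cr \<rho> \<in> Q'" "\<And>b. b \<in> Q' \<Longrightarrow> Q b"
    using PQ(2) unfolding eventually_nhds by auto
  have "\<forall>\<^sub>F r in nhds \<rho>. \<beta>cr r \<in> Q'"
    using curve_continuous[OF \<rho>] Q' by (auto dest: topological_tendstoD)
  moreover have "\<forall>\<^sub>F r in nhds \<rho>. r \<in> {0<..<\<rho>\<^sub>c}"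
    using \<rho> by (intro eventually_nhds_in_open) auto
  ultimately have "\<forall>\<^sub>F r in nhds \<rho>. dist (phase_d s r) (phase_d s \<rho>) < \<epsilon>"
    using PQ(1)
  proof eventually_elim
    case (elim r)
    \<comment> \<open>A vertical approach to the curve at \<open>r\<close>, eventually inside
      \<open>side s\<close>.\<close>
    define b where "b n = \<beta>cr r + s * inverse (real (Suc n))" for n
    have "b \<longlonglongrightarrow> \<beta>cr r + s * 0"
      unfolding b_def by (intro tendsto_intros LIMSEQ_inverse_real_of_nat)
    then have b: "b \<longlonglongrightarrow> \<beta>cr r"
      by simp
    have "\<forall>\<^sub>F n in sequentially. 0 < b n"
      using b curve_pos(2)[OF elim(2)] by (rule order_tendstoD)
    then have side: "\<forall>\<^sub>F n in sequentially. (r, b n) \<in> side s"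
      by eventually_elim (use elim(2) s in \<open>auto simp: side_def b_def\<close>)
    have "filterlim (\<lambda>n. (r, b n)) (at (r, \<beta>cr r) within side s) sequentially"
      unfolding filterlim_at using side
      by (auto intro!: tendsto_Pair b elim!: eventually_mono simp: side_def)
    from filterlim_compose[OF tendsto_phase_d[OF elim(2) s] this]
    have lim: "(\<lambda>n. optimal_d r (b n)) \<longlonglongrightarrow> phase_d s r"
      by simp
    have "\<forall>\<^sub>F n in sequentially. b n \<in> Q'"
      using b Q'(1) elim(1) by (rule topological_tendstoD)
    with side have "\<forall>\<^sub>F n in sequentially. dist (optimal_d r (b n)) (phase_d s \<rho>) \<le> \<epsilon> / 2"
      by eventually_elim (use PQ(3) Q'(3) elim(3) in \<open>auto intro: less_imp_le\<close>)
    then have "dist (phase_d s r) (phase_d s \<rho>) \<le> \<epsilon> / 2"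
      by (intro tendsto_upperbound[OF tendsto_dist[OF lim tendsto_const]]) auto
    then show ?case
      using \<epsilon> by simp
  qed
  then show "\<forall>\<^sub>F r in at \<rho>. dist (phase_d s r) (phase_d s \<rho>) < \<epsilon>"
    by (simp add: eventually_at_filter eventually_mono)
qed

text \<open>On a side the maximizer is unique, so the partial derivatives are explicit continuous
  functions of the parameters and \<open>optimal_d\<close>, whose limit is known.\<close>

lemma phase_derivative_limits:
  assumes \<rho>: "\<rho> \<in> {0<..<\<rho>\<^sub>c}" and s: "s = 1 \<or> s = -1"
  shows "d_rho_limit lam \<beta>cr \<rho>\<^sub>c \<rho> (phase_d s \<rho>) (phase_d s \<rho> / \<rho>)"
    and "d_beta_limit lam \<beta>cr \<rho>\<^sub>c \<rho> (phase_d s \<rho>) (second_moment \<rho> (\<beta>cr \<rho>) (phase_d s \<rho>))"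
proof -
  let ?F = "at (\<rho>, \<beta>cr \<rho>) within side s"
  have phase: "is_phase \<beta>cr \<rho>\<^sub>c \<rho> (phase_d s \<rho>) (side s)"
    unfolding is_phase_def using side_in_curve_sides[OF s] tendsto_phase_d[OF assms] by simp
  have der: "((\<lambda>x. lam x b) has_real_derivative optimal_d r b / r) (at r)"
    "((\<lambda>x. lam r x) has_real_derivative second_moment r b (optimal_d r b)) (at b)"
    if "(r, b) \<in> side s" for r b
    using that unique_on_side[OF that] by (auto intro!: lam_has_derivative_unique simp: side_def)
  have ev: "\<forall>\<^sub>F x in ?F. x \<in> side s"
    by (auto simp: eventually_at_filter)
  have fst: "(fst \<longlongrightarrow> \<rho>) ?F" and snd: "(snd \<longlongrightarrow> \<beta>cr \<rho>) ?F"
    using tendsto_fst[OF tendsto_ident_at, of "(\<rho>, \<beta>cr \<rho>)"]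
      tendsto_snd[OF tendsto_ident_at, of "(\<rho>, \<beta>cr \<rho>)"] by auto
  have opt: "((\<lambda>x. optimal_d (fst x) (snd x)) \<longlongrightarrow> phase_d s \<rho>) ?F"
    using tendsto_phase_d[OF assms] by (simp add: case_prod_unfold)
  have "((\<lambda>(r, b). deriv (\<lambda>x. lam x b) r) \<longlongrightarrow> phase_d s \<rho> / \<rho>) ?F"
  proof (rule Lim_transform_eventually)
    show "((\<lambda>x. optimal_d (fst x) (snd x) / fst x) \<longlongrightarrow> phase_d s \<rho> / \<rho>) ?F"
      using curve_pos[OF \<rho>] by (intro tendsto_intros opt fst) auto
    show "\<forall>\<^sub>F x in ?F. optimal_d (fst x) (snd x) / fst x = (case x of (r, b) \<Rightarrow> deriv (\<lambda>x. lam x b) r)"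
      using ev by eventually_elim (auto dest!: der(1) simp: DERIV_imp_deriv)
  qed
  moreover have "((\<lambda>(r, b). deriv (\<lambda>x. lam r x) b) \<longlongrightarrow> second_moment \<rho> (\<beta>cr \<rho>) (phase_d s \<rho>)) ?F"
  proof (rule Lim_transform_eventually)
    show "((\<lambda>x. second_moment (fst x) (snd x) (optimal_d (fst x) (snd x))) \<longlongrightarrow>
        second_moment \<rho> (\<beta>cr \<rho>) (phase_d s \<rho>)) ?F"
      using curve_pos[OF \<rho>] by (intro tendsto_second_moment opt fst snd) auto
    show "\<forall>\<^sub>F x in ?F. second_moment (fst x) (snd x) (optimal_d (fst x) (snd x)) =
        (case x of (r, b) \<Rightarrow> deriv (\<lambda>x. lam r x) b)"
      using ev by eventually_elim (auto dest!: der(2) simp: DERIV_imp_deriv)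
  qed
  ultimately show "d_rho_limit lam \<beta>cr \<rho>\<^sub>c \<rho> (phase_d s \<rho>) (phase_d s \<rho> / \<rho>)"
    "d_beta_limit lam \<beta>cr \<rho>\<^sub>c \<rho> (phase_d s \<rho>) (second_moment \<rho> (\<beta>cr \<rho>) (phase_d s \<rho>))"
    unfolding d_rho_limit_def d_beta_limit_def using phase der
    by (fastforce simp: real_differentiable_def)+
qed

text \<open>Along the curve the exponent can be differentiated with either of the two maximizers;
  equating the results gives the slope.\<close>

lemma curve_slope:
  assumes \<rho>: "\<rho> \<in> {0<..<\<rho>\<^sub>c}"
  shows "(d2 \<rho> - d1 \<rho>) / \<rho> + deriv \<beta>cr \<rho> *
    (second_moment \<rho> (\<beta>cr \<rho>) (d2 \<rho>) - second_moment \<rho> (\<beta>cr \<rho>) (d1 \<rho>)) = 0"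
proof -
  have der: "(\<beta>cr has_real_derivative deriv \<beta>cr \<rho>) (at \<rho>)"
    using curve_differentiable[OF \<rho>] by (auto simp: real_differentiable_def DERIV_imp_deriv)
  have ev: "\<forall>\<^sub>F r in at \<rho>. r \<in> {0<..<\<rho>\<^sub>c}"
    using \<rho> by (intro eventually_at_in_open') auto
  have "((\<lambda>r. lam r (\<beta>cr r)) has_real_derivative
      1 / \<rho> * phase_d s \<rho> + deriv \<beta>cr \<rho> * second_moment \<rho> (\<beta>cr \<rho>) (phase_d s \<rho>)) (at \<rho>)"
    if s: "s = 1 \<or> s = -1" for s
  proof (rule lam_has_derivative_along[where r = "\<lambda>x. x" and d = "phase_d s"])
    show "\<forall>\<^sub>F r in at \<rho>. phase_d s r \<in> variational_solutions r (\<beta>cr r)"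
      using ev by eventually_elim (simp add: solutions phase_d_def)
    show "phase_d s \<rho> \<in> variational_solutions \<rho> (\<beta>cr \<rho>)"
      using \<rho> by (simp add: solutions phase_d_def)
  qed (use der curve_pos[OF \<rho>] phase_d_continuous[OF \<rho> s] in auto)
  from DERIV_unique[OF this[of 1] this[of "-1"]] show ?thesis
    by (simp add: phase_d_def algebra_simps diff_divide_distrib)
qed

text \<open>The curve is a graph over an open interval, so its limit point is off it and has one
  maximizer, to which hemicontinuity sends both solutions.\<close>

lemma solutions_merge:
  assumes "0 < \<rho>\<^sub>c" "0 < \<beta>\<^sub>c" "(\<beta>cr \<longlongrightarrow> \<beta>\<^sub>c) (at_left \<rho>\<^sub>c)"
  shows "((\<lambda>\<rho>. d2 \<rho> - d1 \<rho>) \<longlongrightarrow> 0) (at_left \<rho>\<^sub>c)"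
proof -
  have ev: "\<forall>\<^sub>F \<rho> in at_left \<rho>\<^sub>c. \<rho> \<in> {0<..<\<rho>\<^sub>c}"
    using eventually_at_left_real[OF assms(1)] .
  have unique: "variational_solutions \<rho>\<^sub>c \<beta>\<^sub>c = {optimal_d \<rho>\<^sub>c \<beta>\<^sub>c}"
    using assms by (intro unique_off_curve) auto
  have "(d \<longlongrightarrow> optimal_d \<rho>\<^sub>c \<beta>\<^sub>c) (at_left \<rho>\<^sub>c)"
    if "\<And>\<rho>. \<rho> \<in> {0<..<\<rho>\<^sub>c} \<Longrightarrow> d \<rho> \<in> variational_solutions \<rho> (\<beta>cr \<rho>)" for d
  proof (rule tendsto_unique_variational_solution[OF tendsto_ident_at assms(3,1,2) unique])
    show "\<forall>\<^sub>F \<rho> in at_left \<rho>\<^sub>c. d \<rho> \<in> variational_solutions \<rho> (\<beta>cr \<rho>)"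
      using ev by eventually_elim (rule that)
  qed
  from tendsto_diff[OF this[of d2] this[of d1]] show ?thesis
    by (simp add: solutions)
qed

end

theorem theorem20:
  fixes M :: "'a measure" and W :: "real \<Rightarrow> 'a \<Rightarrow> real" and x0 :: real
    and lam :: "real \<Rightarrow> real \<Rightarrow> real"
    and \<beta>cr d1 d2 :: "real \<Rightarrow> real" and \<rho>\<^sub>c \<beta>\<^sub>c :: real
  assumes "standard_brownian_motion M W" and "0 < x0"
    and "\<And>\<rho> \<beta>. 0 < \<rho> \<Longrightarrow> 0 < \<beta> \<Longrightarrow> is_lyapunov_exponent M W x0 \<rho> \<beta> (lam \<rho> \<beta>)"
    and "is_critical_point \<rho>\<^sub>c \<beta>\<^sub>c"
    and "phase_transition_curve = (\<lambda>\<rho>. (\<rho>, \<beta>cr \<rho>)) ` {0<..<\<rho>\<^sub>c}"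
    and "\<And>\<rho>. \<rho> \<in> {0<..<\<rho>\<^sub>c} \<Longrightarrow> \<beta>cr differentiable (at \<rho>)"
    and "(\<beta>cr \<longlongrightarrow> \<beta>\<^sub>c) (at_left \<rho>\<^sub>c)"
    and "\<And>\<rho>. \<rho> \<in> {0<..<\<rho>\<^sub>c} \<Longrightarrow>
           d1 \<rho> < d2 \<rho> \<and> variational_solutions \<rho> (\<beta>cr \<rho>) = {d1 \<rho>, d2 \<rho>}"
  shows "(\<forall>\<rho> \<in> {0<..<\<rho>\<^sub>c}. \<exists>R1 R2 B1 B2.
            d_rho_limit lam \<beta>cr \<rho>\<^sub>c \<rho> (d1 \<rho>) R1 \<and> d_rho_limit lam \<beta>cr \<rho>\<^sub>c \<rho> (d2 \<rho>) R2 \<and>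
            d_beta_limit lam \<beta>cr \<rho>\<^sub>c \<rho> (d1 \<rho>) B1 \<and> d_beta_limit lam \<beta>cr \<rho>\<^sub>c \<rho> (d2 \<rho>) B2 \<and>
            B2 - B1 \<noteq> 0 \<and>
            deriv \<beta>cr \<rho> = - ((R2 - R1) / (B2 - B1)) \<and>
            - ((R2 - R1) / (B2 - B1)) = - (2 / (\<rho> * (d1 \<rho> + d2 \<rho>))))
         \<and> ((\<lambda>\<rho>. d2 \<rho> - d1 \<rho>) \<longlongrightarrow> 0) (at_left \<rho>\<^sub>c)"
proof -
  have lim: "(\<lambda>n. ln (partition_sum (\<beta> / (real n)\<^sup>2) \<rho> n 0) / real n) \<longlonglongrightarrow> lam \<rho> \<beta>"
    if "0 < \<rho>" "0 < \<beta>" for \<rho> \<beta>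
    using lyapunov_exponent_limit[OF assms(1,2) that assms(3)[OF that]] .
  \<comment> \<open>At its own base point the subgradient inequality loses both linear terms and
    becomes the reverse of the upper bound.\<close>
  have lam_eq: "lam \<rho> \<beta> = Lambda \<rho> \<beta> d" if "0 < \<rho>" "0 < \<beta>" "d \<in> variational_solutions \<rho> \<beta>" for \<rho> \<beta> d
    using lyapunov_exponent_variational[OF that lim[OF that(1,2)]]
      lyapunov_exponent_subgradient[OF that that(1,2) lim[OF that(1,2)]] by simp
  interpret phase_curve lam \<beta>cr d1 d2 \<rho>\<^sub>c
  proof
    show "lam r0 b0 + (ln \<rho> - ln r0) * d + (\<beta> - b0) * second_moment r0 b0 d \<le> lam \<rho> \<beta>"
      if "0 < r0" "0 < b0" "d \<in> variational_solutions r0 b0" "0 < \<rho>" "0 < \<beta>" for r0 b0 d \<rho> \<beta>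
      using lyapunov_exponent_subgradient[OF that lim[OF that(4,5)]] lam_eq[OF that(1-3)] by simp
  qed (use assms lam_eq in auto)
  have "\<exists>R1 R2 B1 B2.
      d_rho_limit lam \<beta>cr \<rho>\<^sub>c \<rho> (d1 \<rho>) R1 \<and> d_rho_limit lam \<beta>cr \<rho>\<^sub>c \<rho> (d2 \<rho>) R2 \<and>
      d_beta_limit lam \<beta>cr \<rho>\<^sub>c \<rho> (d1 \<rho>) B1 \<and> d_beta_limit lam \<beta>cr \<rho>\<^sub>c \<rho> (d2 \<rho>) B2 \<and>
      B2 - B1 \<noteq> 0 \<and> deriv \<beta>cr \<rho> = - ((R2 - R1) / (B2 - B1)) \<and>
      - ((R2 - R1) / (B2 - B1)) = - (2 / (\<rho> * (d1 \<rho> + d2 \<rho>)))"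
    if \<rho>: "\<rho> \<in> {0<..<\<rho>\<^sub>c}" for \<rho>
  proof -
    define R1 R2 where "R1 = d1 \<rho> / \<rho>" and "R2 = d2 \<rho> / \<rho>"
    define B1 B2 where "B1 = second_moment \<rho> (\<beta>cr \<rho>) (d1 \<rho>)" and "B2 = second_moment \<rho> (\<beta>cr \<rho>) (d2 \<rho>)"
    have "d_rho_limit lam \<beta>cr \<rho>\<^sub>c \<rho> (d1 \<rho>) R1" "d_beta_limit lam \<beta>cr \<rho>\<^sub>c \<rho> (d1 \<rho>) B1"
      using phase_derivative_limits[OF \<rho>, of "-1"] by (auto simp: phase_d_def R1_def B1_def)
    moreover have "d_rho_limit lam \<beta>cr \<rho>\<^sub>c \<rho> (d2 \<rho>) R2" "d_beta_limit lam \<beta>cr \<rho>\<^sub>c \<rho> (d2 \<rho>) B2"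
      using phase_derivative_limits[OF \<rho>, of 1] by (auto simp: phase_d_def R2_def B2_def)
    moreover have B: "B2 - B1 \<noteq> 0"
      using second_moment_jump_pos[OF \<rho>] by (simp add: B1_def B2_def)
    moreover have "(R2 - R1) + deriv \<beta>cr \<rho> * (B2 - B1) = 0"
      using curve_slope[OF \<rho>] by (simp add: R1_def R2_def B1_def B2_def diff_divide_distrib)
    then have "deriv \<beta>cr \<rho> = - ((R2 - R1) / (B2 - B1))"
      using B by (simp add: field_simps)
    moreover have "(R2 - R1) / (B2 - B1) = 2 / (\<rho> * (d1 \<rho> + d2 \<rho>))"
    proof -
      have "B2 - B1 = (d2 \<rho> - d1 \<rho>) * (d1 \<rho> + d2 \<rho>) / 2"
        using second_moment_jump[OF \<rho>] by (simp add: B1_def B2_def algebra_simps power2_eq_square)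
      moreover have "R2 - R1 = (d2 \<rho> - d1 \<rho>) / \<rho>"
        by (simp add: R1_def R2_def diff_divide_distrib)
      ultimately have "(R2 - R1) / (B2 - B1) =
          (d2 \<rho> - d1 \<rho>) / \<rho> / ((d2 \<rho> - d1 \<rho>) * (d1 \<rho> + d2 \<rho>) / 2)"
        by (simp only:)
      also have "\<dots> = 2 / (\<rho> * (d1 \<rho> + d2 \<rho>))"
      proof -
        have "a / \<rho> / (a * c / 2) = 2 / (\<rho> * c)" if "a \<noteq> 0" for a c :: real
          using that by simp
        then show ?thesis
          using d_less[OF \<rho>] by (metis right_minus_eq less_irrefl)
      qed
      finally show ?thesis .
    qed
    ultimately show ?thesis
      by (intro exI[of _ R1] exI[of _ R2] exI[of _ B1] exI[of _ B2]) simp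
  qed
  moreover have "0 < \<rho>\<^sub>c" "0 < \<beta>\<^sub>c"
    using assms(4) by (auto simp: is_critical_point_def)
  ultimately show ?thesis
    using solutions_merge assms(7) by blast
qed

end
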